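(* Let $\boldsymbol{\lambda}^\star\in\mathbb{R}_+^N$ be a vector of rates with $\|\boldsymbol{\lambda}^\star\|_1\le L_0$ for a known $L_0>0$, let $1\le k\le N/2$, let $\tau>0$, and let $n\ge 1$ be an integer. Let $\boldsymbol{A}\in\{0,1\}^{M\times N}$ be the adjacency matrix of $G_{k,N}$, a fixed $(k,1/16)$-expander with left set of size $N$, left degree $d=O(\log(N/k))$ and right set of size $M=O(k\log(N/k))$. Let $\boldsymbol{X}_n$ be the vector of values at time $n\tau$ of $N$ independent homogeneous Poisson processes with rates $\lambda^\star_1,\dots,\lambda^\star_N$, and let $\boldsymbol{Y}_n=\boldsymbol{A}\boldsymbol{X}_n$. Let $\Lambda\subset\mathbb{R}_+^N$ be a sufficiently large finite set of candidate estimators with $\|\boldsymbol{\lambda}\|_1\le L_0$ for all $\boldsymbol{\lambda}\in\Lambda$, and let $\mathrm{pen}:\Lambda\to\mathbb{R}_+$ satisfy the Kraft inequality $\sum_{\boldsymbol{\lambda}\in\Lambda}e^{-\mathrm{pen}(\boldsymbol{\lambda})}\le 1$. Let $c=\dfrac{\gamma}{k\log(N/k)}$, where $\gamma>0$ is chosen so that $c\ll 1$, and let $\widehat{\boldsymbol{\lambda}}^{\mathrm{pMLE}}_n$ be the penalized maximum likelihood estimator built from $\boldsymbol{Y}_n,\Lambda,\mathrm{pen},c$ (defined in the context). Then $$\mathbb{E}_{\boldsymbol{\lambda}^\star}\big\|\widehat{\boldsymbol{\lambda}}^{\mathrm{pMLE}}_n-\boldsymbol{\lambda}^\star\big\|_1=O\Big(\sigma_k(\boldsymbol{\lambda}^\star)+\sqrt{\gamma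 k}\,\log(N/k)\Big)+O\left(\log(N/k)\sqrt{\frac{k}{\gamma}\min_{\boldsymbol{\lambda}\in\Lambda}\left[\|\boldsymbol{\lambda}^\star-\boldsymbol{\lambda}\|_1^2+\frac{\mathrm{pen}(\boldsymbol{\lambda})}{n\tau}\right]}\right).$$
   Context: Expander: a $(k,\varepsilon)$-expander is a bipartite simple graph $G=(A,B,E)$ with left degree $d$ (every vertex of $A$ has degree $d$), such that for any $S\subset A$ with $|S|\le k$, the set of neighbors $\mathcal{N}(S)\subset B$ satisfies $|\mathcal{N}(S)|\ge(1-\varepsilon)d|S|$. Its adjacency matrix is the $|B|\times|A|$ binary matrix whose $(j,i)$ entry is 1 iff $j\in B$ and $i\in A$ are adjacent. For any $1\le k\le N/2$ and $\varepsilon\in(0,1)$ there exists a $(k,\varepsilon)$-expander with left set size $N$, left degree $O(\log(N/k)/\varepsilon)$ and right set size $O(k\log(N/k)/\varepsilon^2)$; $G_{k,N}$ denotes a fixed such expander with $\varepsilon=1/16$. $\Omega\subset A=\{1,\dots,N\}$ denotes a minimal set of size $M$ whose neighborhood covers all of $B$, i.e. $\mathcal{N}(\Omega)=B$, and $\boldsymbol{I}_\Omega\in\{0,1\}^N$ is its indicator vector. For $\boldsymbol{u}\in\mathbb{R}^N$, $\sigma_k(\boldsymbol{u})=\sum_{i\notin S}|u_i|$, where $S$ is the set of positions of the $k$ largest (in magnitude) coordinates of $\boldsymbol{u}$. Likelihood: for $\boldsymbol{\mu}\in\mathbb{R}_+^M$ write $\mathbb{P}_{\boldsymbol{\mu}}(\boldsymbol{z})=\prod_{j=1}^M\mu_j^{z_j}e^{-\mu_j}/z_j!$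 for $\boldsymbol{z}\in\mathbb{Z}_+^M$ (with the limiting convention $1_{\{z_j=0\}}$ when $\mu_j=0$). The law of the counter vector $\boldsymbol{Y}_n$ is taken to be $\mathbb{P}_{n\tau\boldsymbol{A}\boldsymbol{\lambda}^\star}$. Penalized MLE: put $\boldsymbol{\Phi}=\boldsymbol{A}/d$ and $L=n\tau dL_0$. Let $\Lambda_{n,\tau}=\{n\tau d\,\boldsymbol{\lambda}:\boldsymbol{\lambda}\in\Lambda\}$ with $\mathrm{pen}(n\tau d\,\boldsymbol{\lambda}):=\mathrm{pen}(\boldsymbol{\lambda})$, and $\mathcal{F}_c=\{\boldsymbol{f}=\boldsymbol{\theta}+cL\boldsymbol{I}_\Omega:\boldsymbol{\theta}\in\Lambda_{n,\tau}\}$ with $\mathrm{pen}(\boldsymbol{f}):=\mathrm{pen}(\boldsymbol{\theta})$. Then $$\widehat{\boldsymbol{f}}=\arg\min_{\boldsymbol{f}\in\mathcal{F}_c}\big[-\log\mathbb{P}_{\boldsymbol{\Phi}\boldsymbol{f}}(\boldsymbol{Y}_n)+2\,\mathrm{pen}(\boldsymbol{f})\big],\qquad\widehat{\boldsymbol{\theta}}=\widehat{\boldsymbol{f}}-cL\boldsymbol{I}_\Omega,\qquad\widehat{\boldsymbol{\lambda}}^{\mathrm{pMLE}}_n=\frac{\widehat{\boldsymbol{\theta}}}{n\tau d}.$$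
   Formalization: For k = 1 the graph is required to be a (2,1/16)-expander, because a (1,1/16)-expander may give two left vertices the same neighbors and the bound then fails; for k ≥ 2 the (k,1/16)-expander hypothesis is as stated. *)

theory Defs
  imports "HOL-Probability.Probability" "Jordan_Normal_Form.Matrix"
begin

no_notation Finite_Cartesian_Product.vec_nth (infixl \<open>$\<close> 90)

(* Vectors and matrices are the 0-indexed 'vec' and 'mat' of Jordan_Normal_Form, so that the
   dimensions are natural numbers over which statements can quantify.  A bipartite simple graph
   with sides {..<N} (left) and {..<M} (right) is given by its edge set E; the neighbourhood of
   a set S of left vertices is the relational image E `` S. *)

definition nonneg_vecs :: "nat \<Rightarrow> real vec set" where
  "nonneg_vecs N = {v \<in> carrier_vec N. \<forall>i<N. 0 \<le> v $ i}"

definition l1_norm :: "real vec \<Rightarrow> real" where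
  "l1_norm v = (\<Sum>i<dim_vec v. \<bar>v $ i\<bar>)"

definition indicator_vec :: "nat \<Rightarrow> nat set \<Rightarrow> real vec" where
  "indicator_vec N S = vec N (indicator S)"

definition largest_coords :: "nat \<Rightarrow> real vec \<Rightarrow> nat set \<Rightarrow> bool" where
  "largest_coords k u S \<longleftrightarrow> S \<subseteq> {..<dim_vec u} \<and> card S = k \<and>
     (\<forall>i\<in>S. \<forall>j\<in>{..<dim_vec u} - S. \<bar>u $ j\<bar> \<le> \<bar>u $ i\<bar>)"

(* With ties the set of largest coordinates is not unique, but the sum outside it is. *)
definition sigma_k :: "nat \<Rightarrow> real vec \<Rightarrow> real" where
  "sigma_k k u = (\<Sum>i\<in>{..<dim_vec u} - (SOME S. largest_coords k u S). \<bar>u $ i\<bar>)"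

(* For k = 1 the expansion condition only restates left-regularity: all left vertices may then
   share one neighbourhood, and no estimator can separate their rates.  Where recovery of
   1-sparse vectors is claimed, expansion of pairs of vertices has to be required instead,
   i.e. order max k 2. *)
definition expander :: "nat \<Rightarrow> nat \<Rightarrow> (nat \<times> nat) set \<Rightarrow> nat \<Rightarrow> nat \<Rightarrow> real \<Rightarrow> bool" where
  "expander N M E d k \<epsilon> \<longleftrightarrow>
     E \<subseteq> {..<N} \<times> {..<M} \<and>
     (\<forall>i<N. card (E `` {i}) = d) \<and>
     (\<forall>S\<subseteq>{..<N}. card S \<le> k \<longrightarrow>
        real (card (E `` S)) \<ge> (1 - \<epsilon>) * real d * real (card S))"

definition adj_mat :: "nat \<Rightarrow> nat \<Rightarrow> (nat \<times> nat) set \<Rightarrow> real mat" where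
  "adj_mat N M E = mat M N (\<lambda>(j, i). if (i, j) \<in> E then 1 else 0)"

definition covers :: "nat \<Rightarrow> nat \<Rightarrow> (nat \<times> nat) set \<Rightarrow> nat set \<Rightarrow> bool" where
  "covers N M E W \<longleftrightarrow> W \<subseteq> {..<N} \<and> E `` W = {..<M}"

(* "A minimal set of size M covering the right side" cannot combine inclusion-minimality with
   cardinality exactly M unless d = 1: each vertex of a minimal cover owns a private neighbour,
   so exactly M of them leave no other edges.  The condition below is satisfied both by every
   cover of size M and, by the lemma that follows, by every inclusion-minimal cover. *)
definition small_cover :: "nat \<Rightarrow> nat \<Rightarrow> (nat \<times> nat) set \<Rightarrow> nat set \<Rightarrow> bool" where
  "small_cover N M E W \<longleftrightarrow> covers N M E W \<and> card W \<le> M"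

lemma minimal_cover_small:
  assumes "covers N M E W" and min: "\<And>V. V \<subset> W \<Longrightarrow> \<not> covers N M E V"
  shows "small_cover N M E W"
proof -
  have W: "W \<subseteq> {..<N}" "E `` W = {..<M}"
    using assms(1) by (auto simp: covers_def)
  have "\<exists>j. (i, j) \<in> E \<and> (\<forall>i'\<in>W. (i', j) \<in> E \<longrightarrow> i' = i)" if "i \<in> W" for i
  proof (rule ccontr)
    assume a: "\<nexists>j. (i, j) \<in> E \<and> (\<forall>i'\<in>W. (i', j) \<in> E \<longrightarrow> i' = i)"
    have "E `` W \<subseteq> E `` (W - {i})"
      using a by blast
    hence "E `` (W - {i}) = {..<M}"
      using W(2) by blast
    hence "covers N M E (W - {i})"
      using W(1) by (auto simp: covers_def)
    with min[of "W - {i}"] that show False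
      by blast
  qed
  then obtain p where p: "\<And>i. i \<in> W \<Longrightarrow> (i, p i) \<in> E \<and> (\<forall>i'\<in>W. (i', p i) \<in> E \<longrightarrow> i' = i)"
    by metis
  have "inj_on p W" "p ` W \<subseteq> {..<M}"
    using p W(2) by (auto intro!: inj_onI) metis
  hence "card W \<le> card {..<M}"
    by (intro card_inj_on_le) auto
  with assms(1) show ?thesis
    by (simp add: small_cover_def)
qed

(* Since 0 ^ 0 = 1 and 0 ^ n = 0 for n > 0, a factor with rate 0 is the indicator of count 0. *)
definition poisson_lik :: "real vec \<Rightarrow> nat vec \<Rightarrow> real" where
  "poisson_lik \<mu> z =
     (\<Prod>j<dim_vec \<mu>. (\<mu> $ j) ^ (z $ j) * exp (- (\<mu> $ j)) / fact (z $ j))"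

(* poisson_pmf is only specified for positive rates. *)
definition poisson_vec_pmf :: "real vec \<Rightarrow> nat vec pmf" where
  "poisson_vec_pmf \<mu> =
     map_pmf (vec (dim_vec \<mu>))
       (Pi_pmf {..<dim_vec \<mu>} 0
          (\<lambda>j. if 0 < \<mu> $ j then poisson_pmf (\<mu> $ j) else return_pmf 0))"

lemma pmf_poisson_vec:
  assumes mu: "\<mu> \<in> nonneg_vecs M" and z: "z \<in> carrier_vec M"
  shows "pmf (poisson_vec_pmf \<mu>) z = poisson_lik \<mu> z"
proof -
  let ?f = "\<lambda>j. if j < M then z $ j else 0"
  let ?q = "\<lambda>j. if 0 < \<mu> $ j then poisson_pmf (\<mu> $ j) else return_pmf (0::nat)"
  have dim: "dim_vec \<mu> = M" and nn: "\<And>j. j < M \<Longrightarrow> 0 \<le> \<mu> $ j"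
    using mu by (auto simp: nonneg_vecs_def)
  have dz: "dim_vec z = M"
    using z by auto
  have "pmf (poisson_vec_pmf \<mu>) z = measure_pmf.prob (Pi_pmf {..<M} 0 ?q) (vec M -` {z})"
    by (simp add: poisson_vec_pmf_def dim pmf_map)
  also have "\<dots> = measure_pmf.prob (Pi_pmf {..<M} 0 ?q) {?f}"
  proof (rule measure_prob_cong_0)
    fix g assume "g \<in> vec M -` {z} - {?f}"
    then have "vec M g = z" "g \<noteq> ?f"
      by auto
    then obtain j where "j \<notin> {..<M}" "g j \<noteq> 0"
      by (metis index_vec lessThan_iff)
    thus "pmf (Pi_pmf {..<M} 0 ?q) g = 0"
      by (intro pmf_Pi_outside) auto
  next
    fix g assume "g \<in> {?f} - vec M -` {z}"
    moreover have "vec M ?f = z"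
      using dz by (intro eq_vecI) auto
    ultimately show "pmf (Pi_pmf {..<M} 0 ?q) g = 0"
      by auto
  qed
  also have "\<dots> = (\<Prod>j<M. pmf (?q j) (z $ j))"
    by (subst measure_pmf_single, subst pmf_Pi') auto
  also have "\<dots> = (\<Prod>j<M. (\<mu> $ j) ^ (z $ j) * exp (- (\<mu> $ j)) / fact (z $ j))"
  proof (rule prod.cong[OF refl])
    fix j assume "j \<in> {..<M}"
    hence "0 < \<mu> $ j \<or> \<mu> $ j = 0"
      using nn[of j] by auto
    thus "pmf (?q j) (z $ j) = (\<mu> $ j) ^ (z $ j) * exp (- (\<mu> $ j)) / fact (z $ j)"
      by (auto simp: indicator_def)
  qed
  finally show ?thesis
    by (simp add: poisson_lik_def dim)
qed

(* The penalized maximum likelihood estimates for the counts y.  The offset class consists of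
   the vectors f = s l + b with l in Lam, where s = n * tau * d and b = c L I_Omega; the rate
   vector belonging to f is (f - b) / s, and f carries its penalty.  The minimizer need not be
   unique, so this is a predicate on l. *)
definition offset_class :: "real \<Rightarrow> real vec \<Rightarrow> real vec set \<Rightarrow> real vec set" where
  "offset_class s b Lam = (\<lambda>\<theta>. \<theta> + b) ` ((\<lambda>l. s \<cdot>\<^sub>v l) ` Lam)"

definition is_pMLE ::
  "real mat \<Rightarrow> real \<Rightarrow> real vec \<Rightarrow> real vec set \<Rightarrow> (real vec \<Rightarrow> real) \<Rightarrow> nat vec \<Rightarrow> real vec \<Rightarrow> bool"
where
  "is_pMLE \<Phi> s b Lam pen y l \<longleftrightarrow>
     (\<exists>f. is_arg_min
            (\<lambda>f. - ln (poisson_lik (\<Phi> *\<^sub>v f) y) + 2 * pen ((1 / s) \<cdot>\<^sub>v (f - b)))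
            (\<lambda>f. f \<in> offset_class s b Lam) f \<and>
          l = (1 / s) \<cdot>\<^sub>v (f - b))"

end

theory Submission
  imports Defs
begin

text \<open>
  Two ingredients are combined.  On the combinatorial side, expansion bounds
  \<open>||u - v||\<^sub>1\<close> for nonnegative \<open>u, v\<close> by a multiple of \<open>\<sigma>\<^sub>k(v) + ||A (u - v)||\<^sub>1 / d\<close>.
  On the statistical side, the Li--Barron argument bounds the expected squared Hellinger distance
  between the estimated and the true Poisson laws by a \<open>\<chi>\<^sup>2\<close> divergence plus a penalty, for each
  candidate.  The counts are generated without the offset \<open>c L I\<^sub>\<Omega>\<close>, so the model is misspecified;
  the argument does not need the true law to be in the model.  The offset makes every model rate at
  least \<open>c n \<tau> L\<^sub>0\<close>, which controls the \<open>\<chi>\<^sup>2\<close> divergence, and costs at most \<open>c L\<^sub>0 M = O(\<gamma>)\<close>.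
  For \<open>\<gamma> \<ge> 1\<close> the claim is trivial, as the error never exceeds \<open>2 L\<^sub>0\<close>; for \<open>\<gamma> < 1\<close> the
  Cauchy--Schwarz inequality turns the Hellinger bound into a bound on \<open>||A (u - v)||\<^sub>1\<close>.
\<close>

section \<open>Sparse recovery from expansion\<close>

lemma ex_top_subset:
  fixes v :: "'a \<Rightarrow> real"
  assumes "finite U" "b \<le> card U"
  shows "\<exists>T\<subseteq>U. card T = b \<and> (\<forall>i\<in>T. \<forall>j\<in>U - T. v j \<le> v i)"
  using assms(2)
proof (induction b)
  case 0
  show ?case by (intro exI[of _ "{}"]) auto
next
  case (Suc b)
  then obtain T where T: "T \<subseteq> U" "card T = b" "\<forall>i\<in>T. \<forall>j\<in>U - T. v j \<le> v i"
    by auto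
  have "U - T \<noteq> {}" using T Suc.prems by force
  then obtain m where m: "m \<in> U - T" "\<And>j. j \<in> U - T \<Longrightarrow> v j \<le> v m"
    using ex_is_arg_min_if_finite[of "U - T" "\<lambda>i. - v i"] assms(1)
    by (auto simp: is_arg_min_def not_less)
  have "finite T" using T(1) assms(1) finite_subset by blast
  show ?case
    using T m \<open>finite T\<close> by (intro exI[of _ "insert m T"]) auto
qed

text \<open>Shelling argument: blocks of the \<open>b\<close> largest remaining entries are peeled
  off one after another. Every entry of a block is at most the average of the block before it, so a
  block costs at most \<open>W / b\<close> times the sum of its predecessor. Only the first block,
  which has no predecessor, is charged to the a priori bound \<open>m\<close>.\<close>

lemma weighted_sum_le_by_blocks:
  fixes v w :: "'a \<Rightarrow> real"
  assumes "finite U" "0 < b"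
    and "\<And>i. i \<in> U \<Longrightarrow> 0 \<le> v i" "\<And>i. i \<in> U \<Longrightarrow> v i \<le> m" "\<And>i. i \<in> U \<Longrightarrow> 0 \<le> w i"
    and "\<And>T. T \<subseteq> U \<Longrightarrow> card T \<le> b \<Longrightarrow> sum w T \<le> W"
    and "0 \<le> m"
  shows "(\<Sum>i\<in>U. w i * v i) \<le> W * m + W / real b * sum v U"
  using assms(1,3-)
proof (induction "card U" arbitrary: U m rule: less_induct)
  case less
  have W0: "0 \<le> W" using less.prems(5)[of "{}"] by simp
  have bound: "(\<Sum>i\<in>T. w i * v i) \<le> W * m" if "T \<subseteq> U" "card T \<le> b" for T
  proof -
    have "(\<Sum>i\<in>T. w i * v i) \<le> (\<Sum>i\<in>T. w i * m)"
      using that less.prems by (intro sum_mono mult_left_mono) auto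
    also have "\<dots> = sum w T * m" by (simp add: sum_distrib_right)
    also have "\<dots> \<le> W * m" using less.prems(5)[OF that] less.prems(6) by (rule mult_right_mono)
    finally show ?thesis .
  qed
  have v0: "0 \<le> sum v U" using less.prems by (intro sum_nonneg) auto
  show ?case
  proof (cases "card U \<le> b")
    case True
    with bound[of U] W0 v0 show ?thesis by (simp add: add_increasing2)
  next
    case False
    then obtain T where T: "T \<subseteq> U" "card T = b" "\<forall>i\<in>T. \<forall>j\<in>U - T. v j \<le> v i"
      using ex_top_subset[of U b v] less.prems(1) by auto
    have fT: "finite T" using T less.prems(1) finite_subset by blast
    \<comment> \<open>The average of the removed block caps all remaining entries and takes the role
      of \<open>m\<close> in the induction hypothesis.\<close>
    define m' where "m' = sum v T / real b"
    have m': "v j \<le> m'" if "j \<in> U - T" for j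
    proof -
      have "real b * v j = (\<Sum>i\<in>T. v j)" using T by simp
      also have "\<dots> \<le> sum v T" using T that by (intro sum_mono) auto
      finally show ?thesis using assms(2) by (simp add: m'_def field_simps)
    qed
    have "0 \<le> m'" unfolding m'_def
      using T less.prems(2) by (intro divide_nonneg_nonneg sum_nonneg) auto
    have "card (U - T) < card U"
      using T less.prems(1) assms(2) fT by (simp add: card_Diff_subset) (use False in linarith)
    hence "(\<Sum>i\<in>U - T. w i * v i) \<le> W * m' + W / real b * sum v (U - T)"
      using less.prems m' \<open>0 \<le> m'\<close> by (intro less.hyps) (auto intro: less.prems(5))
    moreover have "(\<Sum>i\<in>U. w i * v i) = (\<Sum>i\<in>U - T. w i * v i) + (\<Sum>i\<in>T. w i * v i)"
      using T less.prems(1) by (simp add: sum.subset_diff)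
    moreover have "sum v U = sum v (U - T) + sum v T"
      using T less.prems(1) by (simp add: sum.subset_diff)
    moreover have "(\<Sum>i\<in>T. w i * v i) \<le> W * m" using T by (intro bound) auto
    moreover have "W * m' + W / real b * sum v (U - T) = W / real b * (sum v (U - T) + sum v T)"
      by (simp add: m'_def algebra_simps)
    ultimately show ?thesis by simp
  qed
qed

text \<open>Layer-cake principle: \<open>v\<close> is a nonnegative combination of indicators of its
  superlevel sets, and each of these sets expands by the factor \<alpha>. The induction strips the
  lowest layer at each step, which is why \<open>v\<close> and \<open>g\<close> are
  generalized.\<close>

lemma expansion_sum_le:
  fixes v :: "'a \<Rightarrow> real" and g :: "'b \<Rightarrow> real"
  assumes "finite S" "finite (E `` S)" "0 \<le> \<alpha>"
    and "\<And>T. T \<subseteq> S \<Longrightarrow> \<alpha> * real (card T) \<le> real (card (E `` T))"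
    and "\<And>i. i \<in> S \<Longrightarrow> 0 \<le> v i"
    and "\<And>i j. i \<in> S \<Longrightarrow> (i, j) \<in> E \<Longrightarrow> v i \<le> g j"
  shows "\<alpha> * sum v S \<le> sum g (E `` S)"
  using assms
proof (induction "card S" arbitrary: S v g)
  case 0
  then show ?case by auto
next
  case (Suc n)
  then have "S \<noteq> {}" by auto
  then obtain a where a: "a \<in> S" "\<And>i. i \<in> S \<Longrightarrow> v a \<le> v i"
    using ex_is_arg_min_if_finite[of S v] Suc.prems(1)
    by (auto simp: is_arg_min_def not_less)
  let ?S = "S - {a}" and ?v = "\<lambda>i. v i - v a" and ?g = "\<lambda>j. g j - v a"
  have sub: "E `` ?S \<subseteq> E `` S" by auto
  \<comment> \<open>The layer of height \<open>v a\<close> is subtracted from both functions.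
    Minimality of \<open>v a\<close> keeps the shifted \<open>v\<close> nonnegative on the remaining
    vertices.\<close>
  have "\<alpha> * sum ?v ?S \<le> sum ?g (E `` ?S)"
  proof (rule Suc.hyps(1))
    show "n = card ?S" using Suc.hyps(2) a Suc.prems(1) by simp
    show "finite (E `` ?S)" using sub Suc.prems(2) finite_subset by blast
  qed (use Suc.prems a in \<open>auto intro: Suc.prems(4)\<close>)
  also have "\<dots> \<le> sum ?g (E `` S)"
  proof (rule sum_mono2)
    fix j assume "j \<in> E `` S - E `` ?S"
    then have "(a, j) \<in> E" by auto
    with Suc.prems(6)[OF a(1)] show "0 \<le> g j - v a" by simp
  qed (use sub Suc.prems in auto)
  also have "\<dots> = sum g (E `` S) - real (card (E `` S)) * v a"
    by (simp add: sum_subtractf)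
  finally have 1: "\<alpha> * sum ?v ?S + real (card (E `` S)) * v a \<le> sum g (E `` S)" by simp
  have "\<alpha> * real (card S) * v a \<le> real (card (E `` S)) * v a"
    using Suc.prems(4,5) a(1) by (intro mult_right_mono) auto
  moreover have "sum ?v ?S = sum v S - real (card S) * v a"
  proof -
    have "sum ?v ?S = sum ?v S" using Suc.prems(1) by (intro sum.mono_neutral_left) auto
    thus ?thesis by (simp add: sum_subtractf)
  qed
  ultimately have "\<alpha> * sum v S \<le> \<alpha> * sum ?v ?S + real (card (E `` S)) * v a"
    by (simp add: right_diff_distrib mult.assoc)
  with 1 show ?case by linarith
qed

section \<open>Edge counting and cancellation in row sums\<close>

text \<open>Double counting of the edges between \<open>S\<close> and \<open>B\<close>. It serves
  for signed entries, for moduli and, with \<open>y\<close> constantly 1, for plain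
  counting.\<close>

lemma sum_edges_swap:
  fixes y :: "'a \<Rightarrow> real"
  assumes "finite S" "finite B"
  shows "(\<Sum>j\<in>B. \<Sum>i | i \<in> S \<and> (i, j) \<in> E. y i) = (\<Sum>i\<in>S. real (card (E `` {i} \<inter> B)) * y i)"
proof -
  have "(\<Sum>j\<in>B. \<Sum>i | i \<in> S \<and> (i, j) \<in> E. y i) = (\<Sum>i\<in>S. \<Sum>j | j \<in> B \<and> (i, j) \<in> E. y i)"
    using assms(2,1) by (rule sum.swap_restrict)
  also have "\<dots> = (\<Sum>i\<in>S. real (card (E `` {i} \<inter> B)) * y i)"
  proof (rule sum.cong[OF refl])
    fix i assume "i \<in> S"
    have "{j. j \<in> B \<and> (i, j) \<in> E} = E `` {i} \<inter> B" by auto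
    thus "(\<Sum>j | j \<in> B \<and> (i, j) \<in> E. y i) = real (card (E `` {i} \<inter> B)) * y i" by simp
  qed
  finally show ?thesis .
qed

text \<open>In row \<open>j\<close> the largest term of modulus \<open>g j\<close> is at best cancelled by the other terms,
  so the row sum has modulus at least \<open>2 * g j\<close> minus the sum of the moduli.\<close>

lemma expansion_l1_lower:
  fixes x :: "'a \<Rightarrow> real"
  assumes S: "finite S" and EB: "finite (E `` S)" and "0 \<le> \<alpha>"
    and exp: "\<And>T. T \<subseteq> S \<Longrightarrow> \<alpha> * real (card T) \<le> real (card (E `` T))"
    and deg: "\<And>i. i \<in> S \<Longrightarrow> card (E `` {i}) = d"
  shows "(2 * \<alpha> - real d) * (\<Sum>i\<in>S. \<bar>x i\<bar>) \<le> (\<Sum>j\<in>E `` S. \<bar>\<Sum>i | i \<in> S \<and> (i, j) \<in> E. x i\<bar>)"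
proof -
  define R where "R j = {i. i \<in> S \<and> (i, j) \<in> E}" for j
  define g where "g j = Max ((\<lambda>i. \<bar>x i\<bar>) ` R j)" for j
  have fR: "finite (R j)" for j using S by (simp add: R_def)
  have le_g: "\<bar>x i\<bar> \<le> g j" if "i \<in> R j" for i j
    unfolding g_def using fR that by (intro Max_ge) auto
  have "\<alpha> * (\<Sum>i\<in>S. \<bar>x i\<bar>) \<le> sum g (E `` S)"
    using le_g assms by (intro expansion_sum_le) (auto simp: R_def)
  moreover have "2 * g j - (\<Sum>i\<in>R j. \<bar>x i\<bar>) \<le> \<bar>sum x (R j)\<bar>" if "j \<in> E `` S" for j
  proof -
    have "R j \<noteq> {}" using that by (auto simp: R_def)
    then have "g j \<in> (\<lambda>i. \<bar>x i\<bar>) ` R j" unfolding g_def using fR by (intro Max_in) auto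
    then obtain a where a: "a \<in> R j" "g j = \<bar>x a\<bar>" by auto
    have "sum x (R j) = x a + sum x (R j - {a})" "(\<Sum>i\<in>R j. \<bar>x i\<bar>) = \<bar>x a\<bar> + (\<Sum>i\<in>R j - {a}. \<bar>x i\<bar>)"
      using a fR by (simp_all add: sum.remove)
    moreover have "\<bar>sum x (R j - {a})\<bar> \<le> (\<Sum>i\<in>R j - {a}. \<bar>x i\<bar>)" by (rule sum_abs)
    ultimately show ?thesis using a by linarith
  qed
  hence "(\<Sum>j\<in>E `` S. 2 * g j - (\<Sum>i\<in>R j. \<bar>x i\<bar>)) \<le> (\<Sum>j\<in>E `` S. \<bar>sum x (R j)\<bar>)"
    by (rule sum_mono)
  \<comment> \<open>Each vertex of \<open>S\<close> occurs in exactly \<open>d\<close> rows, all of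
    which belong to the neighbourhood of \<open>S\<close>.\<close>
  moreover have "(\<Sum>j\<in>E `` S. \<Sum>i\<in>R j. \<bar>x i\<bar>) = real d * (\<Sum>i\<in>S. \<bar>x i\<bar>)"
  proof -
    have "E `` {i} \<inter> E `` S = E `` {i}" if "i \<in> S" for i using that by auto
    thus ?thesis
      unfolding R_def sum_edges_swap[OF S EB] using deg by (simp add: sum_distrib_left)
  qed
  ultimately have "2 * (\<alpha> * (\<Sum>i\<in>S. \<bar>x i\<bar>)) - real d * (\<Sum>i\<in>S. \<bar>x i\<bar>) \<le> (\<Sum>j\<in>E `` S. \<bar>sum x (R j)\<bar>)"
    by (simp add: sum_subtractf sum_distrib_left[symmetric])
  thus ?thesis by (simp add: R_def left_diff_distrib)
qed

lemma finite_Image_bounded: "E \<subseteq> {..<N :: nat} \<times> {..<M :: nat} \<Longrightarrow> finite (E `` X)"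
  by (rule finite_subset[of _ "{..<M}"]) auto

text \<open>The vertices of \<open>P\<close> and \<open>T\<close> emit
  \<open>d * (card P + card T)\<close> edges, and expansion leaves at most a fraction \<epsilon> of
  them without a new endpoint. Edges from \<open>T\<close> that end in the neighbourhood of
  \<open>P\<close> are among these.\<close>

lemma expander_collisions_le:
  assumes G: "expander N M E d K \<epsilon>" and "P \<subseteq> {..<N}" "T \<subseteq> {..<N}" "P \<inter> T = {}"
    and "card P + card T \<le> K"
  shows "(\<Sum>i\<in>T. real (card (E `` {i} \<inter> E `` P))) \<le> \<epsilon> * real d * (real (card P) + real (card T))"
proof -
  have fin: "finite P" "finite T" using assms finite_subset by blast+
  have EM: "E \<subseteq> {..<N} \<times> {..<M}" and deg: "\<And>i. i < N \<Longrightarrow> card (E `` {i}) = d"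
    using G by (auto simp: expander_def)
  have fE: "finite (E `` X)" for X by (rule finite_Image_bounded[OF EM])
  have "card (P \<union> T) = card P + card T" using fin assms by (intro card_Un_disjoint) auto
  then have "(1 - \<epsilon>) * real d * (real (card P) + real (card T)) \<le> real (card (E `` (P \<union> T)))"
    using G assms(2,3,5) unfolding expander_def by (metis Un_least of_nat_add)
  moreover have "card (E `` (P \<union> T)) \<le> card (E `` P) + card (\<Union>i\<in>T. E `` {i} - E `` P)"
  proof -
    have "E `` (P \<union> T) = E `` P \<union> (\<Union>i\<in>T. E `` {i} - E `` P)" by auto
    thus ?thesis by (simp only: card_Un_le)
  qed
  moreover have "real (card (E `` P)) \<le> real d * real (card P)"
  proof -
    have "E `` P = (\<Union>i\<in>P. E `` {i})" by auto
    hence "card (E `` P) \<le> (\<Sum>i\<in>P. card (E `` {i}))" using fin by (simp add: card_UN_le)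
    also have "\<dots> = d * card P" using deg assms(2) by (simp add: subset_iff)
    finally show ?thesis unfolding of_nat_mult[symmetric] of_nat_le_iff .
  qed
  moreover have "real (card (\<Union>i\<in>T. E `` {i} - E `` P))
      \<le> real d * real (card T) - (\<Sum>i\<in>T. real (card (E `` {i} \<inter> E `` P)))"
  proof -
    have "real (card (\<Union>i\<in>T. E `` {i} - E `` P)) \<le> (\<Sum>i\<in>T. real (card (E `` {i} - E `` P)))"
      using of_nat_mono[OF card_UN_le[OF fin(2), of "\<lambda>i. E `` {i} - E `` P"], where 'a = real]
      by (simp only: of_nat_sum)
    also have "\<dots> = (\<Sum>i\<in>T. real d - real (card (E `` {i} \<inter> E `` P)))"
    proof (rule sum.cong[OF refl])
      fix i assume "i \<in> T"
      hence "card (E `` {i}) = d" using deg assms(3) by auto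
      thus "real (card (E `` {i} - E `` P)) = real d - real (card (E `` {i} \<inter> E `` P))"
        using card_Int_Diff[OF fE, of "{i}" "E `` P"] by simp
    qed
    finally show ?thesis by (simp add: sum_subtractf mult.commute)
  qed
  ultimately show ?thesis by (simp add: algebra_simps)
qed

section \<open>Null space property and stability of expanders\<close>

text \<open>Expansion of sets of size \<open>k\<close>, rather than the customary \<open>2 * k\<close>, is enough: \<open>S\<close> is cut
  into two halves, and each half together with a block of \<open>b\<close> further coordinates still
  expands.  The price is the constant \<open>5\<close> instead of \<open>2\<close>.\<close>

lemma expander_null_space_top:
  fixes x :: "nat \<Rightarrow> real"
  assumes G: "expander N M E d (max k 2) \<epsilon>" and k: "1 \<le> k" and \<epsilon>: "0 \<le> \<epsilon>" "\<epsilon> \<le> 1"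
    and S: "S \<subseteq> {..<N}" "card S = k" and top: "\<And>i j. i \<in> S \<Longrightarrow> j \<in> {..<N} - S \<Longrightarrow> \<bar>x j\<bar> \<le> \<bar>x i\<bar>"
  shows "(1 - 2 * \<epsilon>) * real d * (\<Sum>i\<in>S. \<bar>x i\<bar>)
    \<le> (\<Sum>j<M. \<bar>\<Sum>i | i < N \<and> (i, j) \<in> E. x i\<bar>) + 5 * \<epsilon> * real d * (\<Sum>i<N. \<bar>x i\<bar>)"
proof -
  have fS: "finite S" using S finite_subset by blast
  have EM: "E \<subseteq> {..<N} \<times> {..<M}" and deg: "\<And>i. i < N \<Longrightarrow> card (E `` {i}) = d"
    using G by (auto simp: expander_def)
  have fE: "finite (E `` X)" for X by (rule finite_Image_bounded[OF EM])
  \<comment> \<open>The block size is such that each half of \<open>S\<close> plus one block has at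
    most \<open>max k 2\<close> elements; at \<open>k = 1\<close> the larger half and the block have
    one element each, which is where pairs must expand. At \<open>k = 3\<close> the bound
    \<open>k \<le> 3 * b\<close> is attained, and \<open>k + 2 * b \<le> 5 * b\<close> yields the
    constant 5.\<close>
  define b where "b = max 1 (k div 2)"
  have b: "0 < b" "b \<le> k" "k \<le> 3 * b" using k by (auto simp: b_def)
  obtain P where P: "P \<subseteq> S" "card P = k div 2"
    using S by (metis obtain_subset_with_card_n div_le_dividend)
  define Q where "Q = S - P"
  have fP: "finite P" using P fS finite_subset by blast
  have Q: "Q \<subseteq> S" "card Q = k - k div 2" "P \<union> Q = S"
    using P fP S by (auto simp: Q_def card_Diff_subset)
  define U where "U = {..<N} - S"
  define w where "w i = real (card (E `` {i} \<inter> E `` S))" for i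
  define W where "W = \<epsilon> * real d * (real k + 2 * real b)"
  have block: "sum w T \<le> W" if T: "T \<subseteq> U" "card T \<le> b" for T
  proof -
    have "w i \<le> real (card (E `` {i} \<inter> E `` P)) + real (card (E `` {i} \<inter> E `` Q))" for i
    proof -
      have "E `` {i} \<inter> E `` S = (E `` {i} \<inter> E `` P) \<union> (E `` {i} \<inter> E `` Q)"
        using Q(3) by auto
      thus ?thesis unfolding w_def of_nat_add[symmetric] of_nat_le_iff by (simp only: card_Un_le)
    qed
    hence "sum w T \<le> (\<Sum>i\<in>T. real (card (E `` {i} \<inter> E `` P))) + (\<Sum>i\<in>T. real (card (E `` {i} \<inter> E `` Q)))"
      by (simp add: sum.distrib[symmetric] sum_mono)
    also have "\<dots> \<le> \<epsilon> * real d * (real (card P) + real (card T)) + \<epsilon> * real d * (real (card Q) + real (card T))"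
      using T P Q S by (intro add_mono expander_collisions_le[OF G]) (auto simp: U_def b_def)
    also have "\<dots> = \<epsilon> * real d * (real (card P + card Q) + 2 * real (card T))"
      by (simp add: algebra_simps)
    also have "card P + card Q = k" using P Q by simp
    also have "\<epsilon> * real d * (real k + 2 * real (card T)) \<le> W"
      unfolding W_def using T(2) \<epsilon> by (intro mult_left_mono) auto
    finally show ?thesis .
  qed
  have W: "0 \<le> W" "W / real b \<le> 5 * \<epsilon> * real d"
  proof -
    show "0 \<le> W" using \<epsilon> by (simp add: W_def)
    have "W \<le> \<epsilon> * real d * (5 * real b)"
      unfolding W_def using b \<epsilon> by (intro mult_left_mono) auto
    thus "W / real b \<le> 5 * \<epsilon> * real d" using b by (simp add: field_simps)
  qed
  \<comment> \<open>The average over \<open>S\<close> bounds all entries outside, since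
    \<open>S\<close> holds the largest coordinates.\<close>
  define m where "m = (\<Sum>i\<in>S. \<bar>x i\<bar>) / real k"
  have "(\<Sum>i\<in>U. w i * \<bar>x i\<bar>) \<le> W * m + W / real b * (\<Sum>i\<in>U. \<bar>x i\<bar>)"
  proof (rule weighted_sum_le_by_blocks)
    fix j assume j: "j \<in> U"
    have "real k * \<bar>x j\<bar> = (\<Sum>i\<in>S. \<bar>x j\<bar>)" using S by simp
    also have "\<dots> \<le> (\<Sum>i\<in>S. \<bar>x i\<bar>)" using top j by (intro sum_mono) (auto simp: U_def)
    finally show "\<bar>x j\<bar> \<le> m" using k by (simp add: m_def field_simps)
  qed (use b block in \<open>auto simp: U_def w_def m_def intro!: divide_nonneg_nonneg sum_nonneg\<close>)
  \<comment> \<open>As \<open>b \<le> k\<close>, the first block costs no more per unit of mass than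
    the later ones, so both sums merge into one over all coordinates.\<close>
  also have "W * m \<le> W / real b * (\<Sum>i\<in>S. \<bar>x i\<bar>)"
    unfolding m_def using b k W(1) by (simp add: frac_le mult_left_mono sum_nonneg)
  also have "W / real b * (\<Sum>i\<in>S. \<bar>x i\<bar>) + W / real b * (\<Sum>i\<in>U. \<bar>x i\<bar>) = W / real b * (\<Sum>i<N. \<bar>x i\<bar>)"
    using S by (simp add: U_def sum.subset_diff[of S "{..<N}"] algebra_simps)
  also have "\<dots> \<le> 5 * \<epsilon> * real d * (\<Sum>i<N. \<bar>x i\<bar>)"
    by (intro mult_right_mono W sum_nonneg) auto
  finally have outer: "(\<Sum>i\<in>U. w i * \<bar>x i\<bar>) \<le> 5 * \<epsilon> * real d * (\<Sum>i<N. \<bar>x i\<bar>)" by simp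

  have "(2 * ((1 - \<epsilon>) * real d) - real d) * (\<Sum>i\<in>S. \<bar>x i\<bar>)
      \<le> (\<Sum>j\<in>E `` S. \<bar>\<Sum>i | i \<in> S \<and> (i, j) \<in> E. x i\<bar>)"
  proof (rule expansion_l1_lower)
    fix T assume "T \<subseteq> S"
    then have "T \<subseteq> {..<N}" "card T \<le> max k 2"
      using S card_mono[OF fS, of T] by auto
    with G show "(1 - \<epsilon>) * real d * real (card T) \<le> real (card (E `` T))"
      by (auto simp: expander_def)
  qed (use fS fE \<epsilon> deg S in auto)
  \<comment> \<open>Completing the row sums from \<open>S\<close> to the whole left side costs the
    outside edges that land in the neighbourhood of \<open>S\<close>; their number at vertex
    \<open>i\<close> is \<open>w i\<close>.\<close>
  also have "\<dots> \<le> (\<Sum>j\<in>E `` S. \<bar>\<Sum>i | i < N \<and> (i, j) \<in> E. x i\<bar> + (\<Sum>i | i \<in> U \<and> (i, j) \<in> E. \<bar>x i\<bar>))"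
  proof (rule sum_mono)
    fix j
    have "{i. i < N \<and> (i, j) \<in> E} = {i. i \<in> S \<and> (i, j) \<in> E} \<union> {i. i \<in> U \<and> (i, j) \<in> E}"
      using S by (auto simp: U_def)
    hence "(\<Sum>i | i < N \<and> (i, j) \<in> E. x i)
        = (\<Sum>i | i \<in> S \<and> (i, j) \<in> E. x i) + (\<Sum>i | i \<in> U \<and> (i, j) \<in> E. x i)"
      using fS by (simp add: U_def) (subst sum.union_disjoint; auto)
    moreover have "\<bar>\<Sum>i | i \<in> U \<and> (i, j) \<in> E. x i\<bar> \<le> (\<Sum>i | i \<in> U \<and> (i, j) \<in> E. \<bar>x i\<bar>)"
      by (rule sum_abs)
    ultimately show "\<bar>\<Sum>i | i \<in> S \<and> (i, j) \<in> E. x i\<bar>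
        \<le> \<bar>\<Sum>i | i < N \<and> (i, j) \<in> E. x i\<bar> + (\<Sum>i | i \<in> U \<and> (i, j) \<in> E. \<bar>x i\<bar>)"
      by linarith
  qed
  also have "\<dots> = (\<Sum>j\<in>E `` S. \<bar>\<Sum>i | i < N \<and> (i, j) \<in> E. x i\<bar>) + (\<Sum>i\<in>U. w i * \<bar>x i\<bar>)"
    unfolding sum.distrib w_def by (subst sum_edges_swap) (auto simp: U_def fE)
  also have "(\<Sum>j\<in>E `` S. \<bar>\<Sum>i | i < N \<and> (i, j) \<in> E. x i\<bar>) \<le> (\<Sum>j<M. \<bar>\<Sum>i | i < N \<and> (i, j) \<in> E. x i\<bar>)"
    using EM by (intro sum_mono2) auto
  finally show ?thesis using outer by (simp add: algebra_simps)
qed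

text \<open>Among all sets of size \<open>k\<close>, the set of largest coordinates carries the most
  mass, so the bound passes to every \<open>S\<close>. This is needed because \<open>S\<close> will
  be chosen for the true rates and not for the error vector \<open>x\<close>.\<close>

lemma expander_null_space:
  fixes x :: "nat \<Rightarrow> real"
  assumes G: "expander N M E d (max k 2) \<epsilon>" and k: "1 \<le> k" and \<epsilon>: "0 \<le> \<epsilon>" "2 * \<epsilon> \<le> 1"
    and S: "S \<subseteq> {..<N}" "card S = k"
  shows "(1 - 2 * \<epsilon>) * real d * (\<Sum>i\<in>S. \<bar>x i\<bar>)
    \<le> (\<Sum>j<M. \<bar>\<Sum>i | i < N \<and> (i, j) \<in> E. x i\<bar>) + 5 * \<epsilon> * real d * (\<Sum>i<N. \<bar>x i\<bar>)"
proof -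
  have fS: "finite S" using S finite_subset by blast
  have "k \<le> card {..<N}" using S card_mono[of "{..<N}" S] by simp
  then obtain T where T: "T \<subseteq> {..<N}" "card T = k" "\<forall>i\<in>T. \<forall>j\<in>{..<N} - T. \<bar>x j\<bar> \<le> \<bar>x i\<bar>"
    using ex_top_subset[of "{..<N}" k "\<lambda>i. \<bar>x i\<bar>"] by auto
  have fT: "finite T" using T finite_subset by blast
  have "card (S - T) = card (T - S)"
    using card_Int_Diff[OF fS, of T] card_Int_Diff[OF fT, of S] S T by (simp add: Int_commute)
  then obtain h where h: "bij_betw h (S - T) (T - S)"
    using finite_same_card_bij[of "S - T" "T - S"] fS fT by auto
  \<comment> \<open>Exchange argument: each element of \<open>S\<close> outside \<open>T\<close> is
    replaced by a different element of \<open>T\<close> outside \<open>S\<close>, whose entry is at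
    least as large.\<close>
  have "(\<Sum>i\<in>S - T. \<bar>x i\<bar>) \<le> (\<Sum>i\<in>S - T. \<bar>x (h i)\<bar>)"
    using T S bij_betw_apply[OF h] by (intro sum_mono) blast
  also have "\<dots> = (\<Sum>i\<in>T - S. \<bar>x i\<bar>)" using h by (rule sum.reindex_bij_betw)
  finally have "(\<Sum>i\<in>S. \<bar>x i\<bar>) \<le> (\<Sum>i\<in>T. \<bar>x i\<bar>)"
    using sum.Int_Diff[OF fS, of "\<lambda>i. \<bar>x i\<bar>" T] sum.Int_Diff[OF fT, of "\<lambda>i. \<bar>x i\<bar>" S]
    by (simp add: Int_commute)
  hence "(1 - 2 * \<epsilon>) * real d * (\<Sum>i\<in>S. \<bar>x i\<bar>) \<le> (1 - 2 * \<epsilon>) * real d * (\<Sum>i\<in>T. \<bar>x i\<bar>)"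
    using \<epsilon> by (intro mult_left_mono) auto
  also have "\<dots> \<le> (\<Sum>j<M. \<bar>\<Sum>i | i < N \<and> (i, j) \<in> E. x i\<bar>) + 5 * \<epsilon> * real d * (\<Sum>i<N. \<bar>x i\<bar>)"
    using T \<epsilon> by (intro expander_null_space_top[OF G k]) auto
  finally show ?thesis .
qed

text \<open>For nonnegative vectors left-regularity turns the measurement error into control of the
  difference of the norms, so no norm constraint on \<open>u\<close> is needed.\<close>

lemma expander_stability:
  fixes u v :: "nat \<Rightarrow> real"
  assumes G: "expander N M E d (max k 2) (1 / 16)" and k: "1 \<le> k" and d: "0 < d"
    and S: "S \<subseteq> {..<N}" "card S = k"
    and u: "\<And>i. i < N \<Longrightarrow> 0 \<le> u i" and v: "\<And>i. i < N \<Longrightarrow> 0 \<le> v i"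
  shows "(\<Sum>i<N. \<bar>u i - v i\<bar>) \<le> 7 * (\<Sum>i\<in>{..<N} - S. \<bar>v i\<bar>)
    + 12 * ((\<Sum>j<M. \<bar>\<Sum>i | i < N \<and> (i, j) \<in> E. u i - v i\<bar>) / real d)"
proof -
  define x where "x i = u i - v i" for i
  define Ax where "Ax = (\<Sum>j<M. \<bar>\<Sum>i | i < N \<and> (i, j) \<in> E. x i\<bar>)"
  define D where "D = Ax / real d"
  have EM: "E \<subseteq> {..<N} \<times> {..<M}" and deg: "\<And>i. i < N \<Longrightarrow> card (E `` {i}) = d"
    using G by (auto simp: expander_def)
  have Ax: "Ax = real d * D" using d by (simp add: D_def)
  have D0: "0 \<le> D" by (simp add: D_def Ax_def sum_nonneg)
  have "(1 - 2 * (1 / 16)) * real d * (\<Sum>i\<in>S. \<bar>x i\<bar>) \<le> Ax + 5 * (1 / 16) * real d * (\<Sum>i<N. \<bar>x i\<bar>)"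
    unfolding Ax_def by (rule expander_null_space[OF G k _ _ S]) auto
  hence "real d * (14 * (\<Sum>i\<in>S. \<bar>x i\<bar>)) \<le> real d * (16 * D + 5 * (\<Sum>i<N. \<bar>x i\<bar>))"
    by (simp add: Ax algebra_simps)
  hence 1: "14 * (\<Sum>i\<in>S. \<bar>x i\<bar>) \<le> 16 * D + 5 * (\<Sum>i<N. \<bar>x i\<bar>)"
    using d by simp
  have "real d * (\<Sum>i<N. x i) = (\<Sum>j<M. \<Sum>i | i \<in> {..<N} \<and> (i, j) \<in> E. x i)"
  proof -
    have "E `` {i} \<inter> {..<M} = E `` {i}" for i using EM by auto
    thus ?thesis by (subst sum_edges_swap) (auto simp: deg sum_distrib_left)
  qed
  also have "\<dots> \<le> Ax" unfolding Ax_def by (intro sum_mono) auto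
  finally have 2: "(\<Sum>i<N. x i) \<le> D" using d by (simp add: Ax)
  have split: "sum g {..<N} = sum g ({..<N} - S) + sum g S" for g :: "nat \<Rightarrow> real"
    using S by (intro sum.subset_diff) auto
  \<comment> \<open>A negative \<open>x i\<close> is at least \<open>- v i\<close> because
    \<open>u i\<close> is nonnegative.\<close>
  have "\<bar>x i\<bar> \<le> x i + 2 * \<bar>v i\<bar>" if "i \<in> {..<N} - S" for i
    using u[of i] v[of i] that by (auto simp: x_def)
  hence "(\<Sum>i\<in>{..<N} - S. \<bar>x i\<bar>) \<le> (\<Sum>i\<in>{..<N} - S. x i + 2 * \<bar>v i\<bar>)" by (rule sum_mono)
  also have "\<dots> = (\<Sum>i\<in>{..<N} - S. x i) + 2 * (\<Sum>i\<in>{..<N} - S. \<bar>v i\<bar>)"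
    by (simp add: sum.distrib sum_distrib_left)
  moreover have "- (\<Sum>i\<in>S. x i) \<le> (\<Sum>i\<in>S. \<bar>x i\<bar>)"
    using sum_abs[of x S] by linarith
  \<comment> \<open>With \<open>X\<close> the total error, \<open>X_S\<close> its part on
    \<open>S\<close> and \<sigma> the tail of \<open>v\<close>, this combines
    \<open>X \<le> 2 * X_S + D + 2 * \<sigma>\<close> with
    \<open>14 * X_S \<le> 16 * D + 5 * X\<close>. The result
    \<open>2 * X \<le> 23 * D + 14 * \<sigma>\<close> is rounded up to the constants 7 and
    12.\<close>
  ultimately have "(\<Sum>i<N. \<bar>x i\<bar>) \<le> 7 * (\<Sum>i\<in>{..<N} - S. \<bar>v i\<bar>) + 12 * D"
    using 1 2 split[of x] split[of "\<lambda>i. \<bar>x i\<bar>"] D0 by linarith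
  thus ?thesis by (simp add: x_def D_def Ax_def)
qed

section \<open>Penalized maximum likelihood for Poisson vectors\<close>

lemma set_pmf_poisson_vec: "set_pmf (poisson_vec_pmf \<mu>) \<subseteq> carrier_vec (dim_vec \<mu>)"
  by (auto simp: poisson_vec_pmf_def)

lemma poisson_lik_pos:
  assumes "\<And>j. j < dim_vec \<mu> \<Longrightarrow> 0 < \<mu> $ j"
  shows "0 < poisson_lik \<mu> y"
  unfolding poisson_lik_def using assms by (intro prod_pos) auto

lemma poisson_mean:
  fixes \<mu> :: real
  assumes "0 < \<mu>"
  shows "integrable (poisson_pmf \<mu>) real" "measure_pmf.expectation (poisson_pmf \<mu>) real = \<mu>"
proof -
  have "(\<lambda>n. \<mu> ^ n /\<^sub>R fact n) sums exp \<mu>" by (rule exp_converges)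
  hence "(\<lambda>n. \<mu> * exp (- \<mu>) * (\<mu> ^ n /\<^sub>R fact n)) sums (\<mu> * exp (- \<mu>) * exp \<mu>)"
    by (rule sums_mult)
  also have "(\<lambda>n. \<mu> * exp (- \<mu>) * (\<mu> ^ n /\<^sub>R fact n))
      = (\<lambda>n. pmf (poisson_pmf \<mu>) (Suc n) * real (Suc n))"
    using assms by (simp add: fun_eq_iff field_simps del: of_nat_Suc)
  also have "\<mu> * exp (- \<mu>) * exp \<mu> = \<mu>" by (simp add: exp_minus)
  \<comment> \<open>The series can be shifted by one index because its term at 0 vanishes.\<close>
  finally have s: "(\<lambda>n. pmf (poisson_pmf \<mu>) n * real n) sums \<mu>"
    by (subst (asm) sums_Suc_iff) simp
  have "has_bochner_integral (count_space UNIV) (\<lambda>n. pmf (poisson_pmf \<mu>) n * real n) \<mu>"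
  proof -
    have "integrable (count_space UNIV) (\<lambda>n. pmf (poisson_pmf \<mu>) n * real n)"
      using s by (simp add: integrable_count_space_nat_iff sums_iff abs_mult)
    thus ?thesis
      using sums_integral_count_space_nat s sums_unique2
      by (metis has_bochner_integral_iff)
  qed
  thus "integrable (poisson_pmf \<mu>) real" "measure_pmf.expectation (poisson_pmf \<mu>) real = \<mu>"
    unfolding measure_pmf_eq_density
    by (simp_all add: integrable_density integral_density has_bochner_integral_iff)
qed

lemma poisson_vec_mean:
  assumes "\<mu> \<in> nonneg_vecs M" "j < M"
  shows "integrable (poisson_vec_pmf \<mu>) (\<lambda>y. real (y $ j))"
    "measure_pmf.expectation (poisson_vec_pmf \<mu>) (\<lambda>y. real (y $ j)) = \<mu> $ j"
proof -
  define q where "q = (if 0 < \<mu> $ j then poisson_pmf (\<mu> $ j) else return_pmf 0)"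
  have dim: "dim_vec \<mu> = M" and nn: "0 \<le> \<mu> $ j" using assms by (auto simp: nonneg_vecs_def)
  have "map_pmf (\<lambda>y. y $ j) (poisson_vec_pmf \<mu>)
      = map_pmf (\<lambda>f. f j) (Pi_pmf {..<M} 0 (\<lambda>j. if 0 < \<mu> $ j then poisson_pmf (\<mu> $ j) else return_pmf 0))"
    unfolding poisson_vec_pmf_def dim map_pmf_comp using assms(2) by (intro map_pmf_cong) auto
  also have "\<dots> = q" using assms(2) by (subst Pi_pmf_component) (auto simp: q_def)
  finally have q: "map_pmf (\<lambda>y. y $ j) (poisson_vec_pmf \<mu>) = q" .
  have "integrable q real" "measure_pmf.expectation q real = \<mu> $ j"
    using nn poisson_mean[of "\<mu> $ j"] by (auto simp: q_def intro: integrable_measure_pmf_finite)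
  thus "integrable (poisson_vec_pmf \<mu>) (\<lambda>y. real (y $ j))"
    "measure_pmf.expectation (poisson_vec_pmf \<mu>) (\<lambda>y. real (y $ j)) = \<mu> $ j"
    unfolding q[symmetric] integral_map_pmf integrable_map_pmf_eq .
qed

section \<open>Hellinger distance and log-likelihood ratios\<close>

text \<open>A distance of rates rather than of laws: the affinity of two Poisson laws is
  \<open>exp (- hellinger_vec \<mu> \<nu> / 2)\<close>, so this is minus twice the logarithm of the
  affinity.\<close>

definition hellinger_vec :: "real vec \<Rightarrow> real vec \<Rightarrow> real" where
  "hellinger_vec \<mu> \<nu> = (\<Sum>j<dim_vec \<mu>. (sqrt (\<mu> $ j) - sqrt (\<nu> $ j))\<^sup>2)"

text \<open>Also formed from the rates. For positive \<nu> it is the mean under \<mu> of a linear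
  upper bound for the log-likelihood ratio, and hence dominates the Kullback-Leibler
  divergence.\<close>

definition chi2_vec :: "real vec \<Rightarrow> real vec \<Rightarrow> real" where
  "chi2_vec \<mu> \<nu> = (\<Sum>j<dim_vec \<mu>. (\<mu> $ j - \<nu> $ j)\<^sup>2 / \<nu> $ j)"

lemma sqrt_prod: "sqrt (prod f A) = (\<Prod>x\<in>A. sqrt (f x))"
  by (induction A rule: infinite_finite_induct) (simp_all add: real_sqrt_mult)

text \<open>The geometric mean of two Poisson weights is a Poisson weight at the geometric mean of
  the rates, up to a constant. The constant comes from completing the square, as half of
  \<open>\<mu> + \<nu>\<close> equals \<open>sqrt (\<mu> * \<nu>)\<close> plus half the squared
  difference of the roots.\<close>

lemma sqrt_poisson_lik_mult:
  assumes "\<mu> \<in> nonneg_vecs M" "\<nu> \<in> nonneg_vecs M"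
  shows "sqrt (poisson_lik \<mu> y * poisson_lik \<nu> y)
    = exp (- hellinger_vec \<mu> \<nu> / 2) * poisson_lik (vec M (\<lambda>j. sqrt (\<mu> $ j * \<nu> $ j))) y"
proof -
  have dim: "dim_vec \<mu> = M" "dim_vec \<nu> = M" and nn: "\<And>j. j < M \<Longrightarrow> 0 \<le> \<mu> $ j" "\<And>j. j < M \<Longrightarrow> 0 \<le> \<nu> $ j"
    using assms by (auto simp: nonneg_vecs_def)
  have "sqrt (poisson_lik \<mu> y * poisson_lik \<nu> y)
      = (\<Prod>j<M. sqrt (((\<mu> $ j) ^ (y $ j) * exp (- (\<mu> $ j)) / fact (y $ j))
            * ((\<nu> $ j) ^ (y $ j) * exp (- (\<nu> $ j)) / fact (y $ j))))"
    by (simp add: poisson_lik_def dim prod.distrib[symmetric] sqrt_prod)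
  also have "\<dots> = (\<Prod>j<M. exp (- (sqrt (\<mu> $ j) - sqrt (\<nu> $ j))\<^sup>2 / 2)
      * (sqrt (\<mu> $ j * \<nu> $ j) ^ (y $ j) * exp (- sqrt (\<mu> $ j * \<nu> $ j)) / fact (y $ j)))"
  proof (rule prod.cong[OF refl])
    fix j assume "j \<in> {..<M}"
    then have a: "0 \<le> \<mu> $ j" "0 \<le> \<nu> $ j" using nn by auto
    let ?e = "exp (- (\<mu> $ j) / 2 - \<nu> $ j / 2)"
    have "((\<mu> $ j) ^ (y $ j) * exp (- (\<mu> $ j)) / fact (y $ j))
            * ((\<nu> $ j) ^ (y $ j) * exp (- (\<nu> $ j)) / fact (y $ j))
        = (sqrt (\<mu> $ j * \<nu> $ j) ^ (y $ j) * ?e / fact (y $ j))\<^sup>2"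
    proof -
      have "(sqrt (\<mu> $ j * \<nu> $ j) ^ (y $ j))\<^sup>2 = (\<mu> $ j) ^ (y $ j) * (\<nu> $ j) ^ (y $ j)"
        using a by (simp add: power_even_eq[symmetric] power_mult power_mult_distrib)
      moreover have "?e\<^sup>2 = exp (- (\<mu> $ j)) * exp (- (\<nu> $ j))"
        by (simp add: exp_double[symmetric] exp_add[symmetric])
      moreover have "(r * ?e / x)\<^sup>2 = r\<^sup>2 * ?e\<^sup>2 / (x * x)" for r x :: real
        by (simp only: power_divide power_mult_distrib power2_eq_square[of x])
      ultimately show ?thesis by (simp only: times_divide_times_eq mult.assoc mult.left_commute)
    qed
    hence "sqrt (((\<mu> $ j) ^ (y $ j) * exp (- (\<mu> $ j)) / fact (y $ j))
            * ((\<nu> $ j) ^ (y $ j) * exp (- (\<nu> $ j)) / fact (y $ j)))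
        = sqrt (\<mu> $ j * \<nu> $ j) ^ (y $ j) * ?e / fact (y $ j)"
      using a by simp
    moreover have "?e = exp (- (sqrt (\<mu> $ j) - sqrt (\<nu> $ j))\<^sup>2 / 2) * exp (- sqrt (\<mu> $ j * \<nu> $ j))"
      using a by (simp add: exp_add[symmetric] power2_diff real_sqrt_mult field_simps)
    ultimately show "sqrt (((\<mu> $ j) ^ (y $ j) * exp (- (\<mu> $ j)) / fact (y $ j))
            * ((\<nu> $ j) ^ (y $ j) * exp (- (\<nu> $ j)) / fact (y $ j)))
        = exp (- (sqrt (\<mu> $ j) - sqrt (\<nu> $ j))\<^sup>2 / 2)
      * (sqrt (\<mu> $ j * \<nu> $ j) ^ (y $ j) * exp (- sqrt (\<mu> $ j * \<nu> $ j)) / fact (y $ j))"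
      by simp
  qed
  also have "\<dots> = exp (- hellinger_vec \<mu> \<nu> / 2) * poisson_lik (vec M (\<lambda>j. sqrt (\<mu> $ j * \<nu> $ j))) y"
  proof -
    have "- hellinger_vec \<mu> \<nu> / 2 = (\<Sum>j<M. - (sqrt (\<mu> $ j) - sqrt (\<nu> $ j))\<^sup>2 / 2)"
      unfolding hellinger_vec_def dim sum_negf[symmetric] sum_divide_distrib ..
    hence "exp (- hellinger_vec \<mu> \<nu> / 2) = (\<Prod>j<M. exp (- (sqrt (\<mu> $ j) - sqrt (\<nu> $ j))\<^sup>2 / 2))"
      by (simp only: exp_sum finite_lessThan)
    moreover have "poisson_lik (vec M (\<lambda>j. sqrt (\<mu> $ j * \<nu> $ j))) y
        = (\<Prod>j<M. sqrt (\<mu> $ j * \<nu> $ j) ^ (y $ j) * exp (- sqrt (\<mu> $ j * \<nu> $ j)) / fact (y $ j))"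
      by (simp add: poisson_lik_def)
    ultimately show ?thesis by (simp only: prod.distrib[symmetric])
  qed
  finally show ?thesis .
qed

text \<open>Weighting the root of the ratio by the law of \<mu> gives the geometric mean of the
  likelihoods, a constant times the Poisson weight at the rates \<rho>, which has total mass
  1.\<close>

lemma poisson_affinity_le:
  assumes \<mu>: "\<mu> \<in> nonneg_vecs M" and \<nu>: "\<nu> \<in> nonneg_vecs M"
  shows "(\<integral>\<^sup>+ y. ennreal (sqrt (poisson_lik \<nu> y / poisson_lik \<mu> y)) \<partial>poisson_vec_pmf \<mu>)
    \<le> ennreal (exp (- hellinger_vec \<mu> \<nu> / 2))"
proof -
  define \<rho> where "\<rho> = vec M (\<lambda>j. sqrt (\<mu> $ j * \<nu> $ j))"
  have \<rho>: "\<rho> \<in> nonneg_vecs M" using \<mu> \<nu> by (auto simp: nonneg_vecs_def \<rho>_def)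
  have dim: "dim_vec \<mu> = M" using \<mu> by (auto simp: nonneg_vecs_def)
  let ?c = "exp (- hellinger_vec \<mu> \<nu> / 2)"
  have "ennreal (pmf (poisson_vec_pmf \<mu>) y) * ennreal (sqrt (poisson_lik \<nu> y / poisson_lik \<mu> y))
      \<le> ennreal ?c * ennreal (pmf (poisson_vec_pmf \<rho>) y)" for y
  proof (cases "y \<in> set_pmf (poisson_vec_pmf \<mu>)")
    case True
    then have y: "y \<in> carrier_vec M" using set_pmf_poisson_vec[of \<mu>] dim by auto
    have p: "poisson_lik \<mu> y > 0"
      using True pmf_poisson_vec[OF \<mu> y] by (metis pmf_positive)
    have "poisson_lik \<mu> y * sqrt (poisson_lik \<nu> y / poisson_lik \<mu> y)
        = sqrt (poisson_lik \<mu> y * poisson_lik \<nu> y)"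
      using p by (simp add: real_sqrt_mult real_sqrt_divide field_simps)
    also have "\<dots> = ?c * poisson_lik \<rho> y" unfolding \<rho>_def by (rule sqrt_poisson_lik_mult[OF \<mu> \<nu>])
    finally show ?thesis
      unfolding pmf_poisson_vec[OF \<mu> y] pmf_poisson_vec[OF \<rho> y] using p
      by (simp add: ennreal_mult'[symmetric] ennreal_mult''[symmetric])
  qed (simp add: set_pmf_iff)
  hence "(\<integral>\<^sup>+ y. ennreal (sqrt (poisson_lik \<nu> y / poisson_lik \<mu> y)) \<partial>poisson_vec_pmf \<mu>)
      \<le> (\<integral>\<^sup>+ y. ennreal ?c * ennreal (pmf (poisson_vec_pmf \<rho>) y) \<partial>count_space UNIV)"
    unfolding nn_integral_measure_pmf by (intro nn_integral_mono)
  also have "\<dots> = ennreal ?c"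
    by (simp add: nn_integral_cmult nn_integral_pmf)
  finally show ?thesis .
qed

text \<open>\<open>ln (a / b) \<le> a / b - 1\<close> makes the log-likelihood ratio linear in the counts.\<close>

lemma ln_poisson_lik_ratio_le:
  assumes \<mu>: "\<mu> \<in> nonneg_vecs M" and \<nu>: "\<nu> \<in> carrier_vec M" "\<And>j. j < M \<Longrightarrow> 0 < \<nu> $ j"
    and y: "0 < poisson_lik \<mu> y"
  shows "ln (poisson_lik \<mu> y) - ln (poisson_lik \<nu> y)
    \<le> (\<Sum>j<M. real (y $ j) * (\<mu> $ j / \<nu> $ j - 1) - \<mu> $ j + \<nu> $ j)"
proof -
  have dim: "dim_vec \<mu> = M" "dim_vec \<nu> = M" and nn: "\<And>j. j < M \<Longrightarrow> 0 \<le> \<mu> $ j"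
    using assms by (auto simp: nonneg_vecs_def)
  let ?p = "\<lambda>\<mu> j. (\<mu> $ j) ^ (y $ j) * exp (- (\<mu> $ j)) / fact (y $ j) :: real"
  have nz: "?p \<mu> j > 0" if "j < M" for j
  proof -
    have "?p \<mu> j \<noteq> 0"
    proof
      assume "?p \<mu> j = 0"
      with that have "(\<Prod>j<M. ?p \<mu> j) = 0" by (intro prod_zero) auto
      with y show False by (simp add: poisson_lik_def dim)
    qed
    moreover have "?p \<mu> j \<ge> 0" using nn[OF that] by simp
    ultimately show ?thesis by linarith
  qed
  have "ln (poisson_lik \<mu> y) = (\<Sum>j<M. ln (?p \<mu> j))"
    unfolding poisson_lik_def dim by (rule ln_prod) (simp_all only: lessThan_iff finite_lessThan nz[THEN less_imp_neq, symmetric] not_False_eq_True)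
  moreover have "ln (poisson_lik \<nu> y) = (\<Sum>j<M. ln (?p \<nu> j))"
    unfolding poisson_lik_def dim using \<nu>(2) by (subst ln_prod) (auto simp: less_imp_neq[symmetric])
  moreover have "ln (?p \<mu> j) - ln (?p \<nu> j) \<le> real (y $ j) * (\<mu> $ j / \<nu> $ j - 1) - \<mu> $ j + \<nu> $ j"
    if j: "j < M" for j
  proof (cases "\<mu> $ j = 0")
    case True
    \<comment> \<open>A nonzero count at rate 0 would annihilate the likelihood. With count 0 both
      sides reduce to \<open>\<nu> $ j\<close>.\<close>
    have "y $ j = 0"
    proof (rule ccontr)
      assume "y $ j \<noteq> 0"
      with True nz[OF j] show False by (simp add: zero_power)
    qed
    with True show ?thesis by simp
  next
    case False
    then have pos: "0 < \<mu> $ j" "0 < \<nu> $ j" using nn[OF j] \<nu>(2)[OF j] by auto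
    have "ln (?p \<mu> j) - ln (?p \<nu> j) = real (y $ j) * ln (\<mu> $ j / \<nu> $ j) - \<mu> $ j + \<nu> $ j"
    proof -
      have "ln (x ^ n * exp (- x) / fact n) = real n * ln x - x - ln (fact n)" if "0 < x" for x :: real and n
        using that by (simp add: ln_div ln_mult ln_realpow)
      with pos show ?thesis by (simp add: ln_div right_diff_distrib)
    qed
    also have "real (y $ j) * ln (\<mu> $ j / \<nu> $ j) \<le> real (y $ j) * (\<mu> $ j / \<nu> $ j - 1)"
      using pos by (intro mult_left_mono ln_le_minus_one) auto
    finally show ?thesis by simp
  qed
  ultimately show ?thesis
    by (simp only: sum_subtractf[symmetric]) (intro sum_mono, simp)
qed

text \<open>The bound \<open>g\<close> is affine in the counts, so each count may be replaced by its
  mean \<open>\<mu> $ j\<close>; the outcome collects into a square over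
  \<open>\<nu> $ j\<close>.\<close>

lemma expectation_ln_ratio_bound:
  assumes \<mu>: "\<mu> \<in> nonneg_vecs M" and \<nu>: "\<nu> \<in> carrier_vec M" "\<And>j. j < M \<Longrightarrow> 0 < \<nu> $ j"
  defines "g \<equiv> \<lambda>y. \<Sum>j<M. real (y $ j) * (\<mu> $ j / \<nu> $ j - 1) - \<mu> $ j + \<nu> $ j"
  shows "integrable (poisson_vec_pmf \<mu>) g"
    "measure_pmf.expectation (poisson_vec_pmf \<mu>) g = chi2_vec \<mu> \<nu>"
proof -
  note mean = poisson_vec_mean[OF \<mu>]
  show "integrable (poisson_vec_pmf \<mu>) g"
    unfolding g_def using mean(1) by auto
  have "dim_vec \<mu> = M" using \<mu> by (auto simp: nonneg_vecs_def)
  have "measure_pmf.expectation (poisson_vec_pmf \<mu>) g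
      = (\<Sum>j<M. \<mu> $ j * (\<mu> $ j / \<nu> $ j - 1) - \<mu> $ j + \<nu> $ j)"
    unfolding g_def using mean by (simp add: Bochner_Integration.integral_sum)
  also have "\<dots> = chi2_vec \<mu> \<nu>"
    unfolding chi2_vec_def \<open>dim_vec \<mu> = M\<close>
  proof (rule sum.cong[OF refl])
    fix j assume "j \<in> {..<M}"
    with \<nu>(2) have "\<nu> $ j \<noteq> 0" by force
    thus "\<mu> $ j * (\<mu> $ j / \<nu> $ j - 1) - \<mu> $ j + \<nu> $ j = (\<mu> $ j - \<nu> $ j)\<^sup>2 / \<nu> $ j"
      by (simp add: field_simps power2_eq_square)
  qed
  finally show "measure_pmf.expectation (poisson_vec_pmf \<mu>) g = chi2_vec \<mu> \<nu>" .
qed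

section \<open>Risk bound for penalized maximum likelihood\<close>

text \<open>The true rates \<open>\<mu>\<close> need not belong to the model \<open>m ` \<Theta>\<close>.  With
  \<open>Z = exp (hellinger / 2 - pen) * sqrt (lik (m l) / lik \<mu>)\<close> evaluated at the estimate, the
  Hellinger distance is \<open>2 * ln Z\<close> plus a penalized log-likelihood ratio that can only increase
  when the estimate is replaced by a fixed \<open>l\<close>; and \<open>Z\<close> is dominated by a sum over the model
  whose expectation is at most 1 by the Kraft inequality.\<close>

lemma penalized_mle_hellinger_bound:
  fixes m :: "'a \<Rightarrow> real vec" and pen :: "'a \<Rightarrow> real"
  assumes \<mu>: "\<mu> \<in> nonneg_vecs M" and fin: "finite \<Theta>"
    and m: "\<And>l. l \<in> \<Theta> \<Longrightarrow> m l \<in> carrier_vec M" "\<And>l j. l \<in> \<Theta> \<Longrightarrow> j < M \<Longrightarrow> 0 < m l $ j"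
    and kraft: "(\<Sum>l\<in>\<Theta>. exp (- pen l)) \<le> 1"
    and est: "\<And>y. y \<in> carrier_vec M \<Longrightarrow> lhat y \<in> \<Theta>"
      "\<And>y l. y \<in> carrier_vec M \<Longrightarrow> l \<in> \<Theta> \<Longrightarrow>
        - ln (poisson_lik (m (lhat y)) y) + 2 * pen (lhat y) \<le> - ln (poisson_lik (m l) y) + 2 * pen l"
    and l: "l \<in> \<Theta>"
  shows "measure_pmf.expectation (poisson_vec_pmf \<mu>) (\<lambda>y. hellinger_vec \<mu> (m (lhat y)))
    \<le> chi2_vec \<mu> (m l) + 2 * pen l"
proof -
  let ?P = "poisson_vec_pmf \<mu>"
  have dim: "dim_vec \<mu> = M" using \<mu> by (auto simp: nonneg_vecs_def)
  have mn: "m l \<in> nonneg_vecs M" if "l \<in> \<Theta>" for l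
    using m that by (auto simp: nonneg_vecs_def less_imp_le)
  have supp: "y \<in> carrier_vec M" "0 < poisson_lik \<mu> y" if "y \<in> set_pmf ?P" for y
  proof -
    show y: "y \<in> carrier_vec M" using that set_pmf_poisson_vec[of \<mu>] dim by auto
    show "0 < poisson_lik \<mu> y" using that pmf_poisson_vec[OF \<mu> y] by (metis pmf_positive)
  qed
  have nonneg: "0 \<le> poisson_lik \<nu> y" if "\<nu> \<in> nonneg_vecs M" for \<nu> y
    using that by (auto simp: poisson_lik_def nonneg_vecs_def intro!: prod_nonneg)
  define h where "h l = hellinger_vec \<mu> (m l)" for l
  define Z where "Z l y = exp (h l / 2 - pen l) * sqrt (poisson_lik (m l) y / poisson_lik \<mu> y)" for l y
  define W where "W y = (\<Sum>l\<in>\<Theta>. Z l y)" for y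
  define g where "g y = (\<Sum>j<M. real (y $ j) * (\<mu> $ j / m l $ j - 1) - \<mu> $ j + m l $ j)" for y
  have Z0: "0 \<le> Z l y" if "l \<in> \<Theta>" for l y
    unfolding Z_def using nonneg[OF mn[OF that]] nonneg[OF \<mu>] by simp
  have EW: "(\<integral>\<^sup>+ y. ennreal (W y) \<partial>?P) \<le> 1"
  proof -
    have "(\<integral>\<^sup>+ y. ennreal (W y) \<partial>?P) = (\<Sum>l\<in>\<Theta>. \<integral>\<^sup>+ y. ennreal (Z l y) \<partial>?P)"
    proof -
      have "ennreal (W y) = (\<Sum>l\<in>\<Theta>. ennreal (Z l y))" for y
        by (simp add: W_def sum_ennreal Z0)
      thus ?thesis by (simp add: nn_integral_sum)
    qed
    also have "\<dots> \<le> (\<Sum>l\<in>\<Theta>. ennreal (exp (- pen l)))"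
    proof (rule sum_mono)
      fix l assume l: "l \<in> \<Theta>"
      have "(\<integral>\<^sup>+ y. ennreal (Z l y) \<partial>?P)
          = ennreal (exp (h l / 2 - pen l)) * (\<integral>\<^sup>+ y. ennreal (sqrt (poisson_lik (m l) y / poisson_lik \<mu> y)) \<partial>?P)"
        unfolding Z_def by (simp add: ennreal_mult' nn_integral_cmult)
      \<comment> \<open>The factor \<open>exp (h l / 2)\<close> in \<open>Z\<close> is chosen to
        cancel the affinity exactly, so that only the Kraft weight remains.\<close>
      also have "\<dots> \<le> ennreal (exp (h l / 2 - pen l)) * ennreal (exp (- h l / 2))"
        unfolding h_def by (intro mult_left_mono poisson_affinity_le[OF \<mu> mn[OF l]]) auto
      also have "\<dots> = ennreal (exp (- pen l))"
        by (simp add: ennreal_mult'[symmetric] exp_add[symmetric])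
      finally show "(\<integral>\<^sup>+ y. ennreal (Z l y) \<partial>?P) \<le> ennreal (exp (- pen l))" .
    qed
    also have "\<dots> = ennreal (\<Sum>l\<in>\<Theta>. exp (- pen l))" by (simp add: sum_ennreal)
    also have "\<dots> \<le> 1" using kraft by simp
    finally show ?thesis .
  qed
  have W0: "0 \<le> W y" for y unfolding W_def using Z0 by (intro sum_nonneg) auto
  have intW: "integrable ?P W"
    using EW W0 by (intro integrableI_nonneg) (auto intro: order_le_less_trans)
  have "ennreal (measure_pmf.expectation ?P W) \<le> 1"
    using EW nn_integral_eq_integral[OF intW] W0 by simp
  hence EW': "measure_pmf.expectation ?P W \<le> 1" by simp
  note g = expectation_ln_ratio_bound[OF \<mu> m(1)[OF l] m(2)[OF l], folded g_def]
  have pw: "h (lhat y) \<le> 2 * (W y - 1) + g y + 2 * pen l" if y: "y \<in> set_pmf ?P" for y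
  proof -
    have lh: "lhat y \<in> \<Theta>" using est(1) supp(1)[OF y] by blast
    have p: "0 < poisson_lik \<mu> y" "0 < poisson_lik (m (lhat y)) y"
      using supp(2)[OF y] m[OF lh] by (auto intro!: poisson_lik_pos)
    have Zpos: "0 < Z (lhat y) y" using p by (simp add: Z_def)
    have "ln (Z (lhat y) y) \<le> Z (lhat y) y - 1" using Zpos by (rule ln_le_minus_one)
    \<comment> \<open>The estimate depends on the data, whereas \<open>W\<close> sums over the whole
      model; this is what makes the expectation computable.\<close>
    also have "Z (lhat y) y \<le> W y"
      unfolding W_def using fin lh Z0 by (intro member_le_sum) auto
    finally have "ln (Z (lhat y) y) \<le> W y - 1" by simp
    moreover have "ln (Z (lhat y) y) = h (lhat y) / 2 - pen (lhat y)
        + (ln (poisson_lik (m (lhat y)) y) - ln (poisson_lik \<mu> y)) / 2"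
      unfolding Z_def using p by (simp add: ln_mult ln_sqrt ln_div)
    moreover have "ln (poisson_lik \<mu> y) - ln (poisson_lik (m l) y) \<le> g y"
      unfolding g_def by (rule ln_poisson_lik_ratio_le[OF \<mu> m(1)[OF l] m(2)[OF l] p(1)])
    moreover have "- ln (poisson_lik (m (lhat y)) y) + 2 * pen (lhat y) \<le> - ln (poisson_lik (m l) y) + 2 * pen l"
      by (rule est(2)[OF supp(1)[OF y] l])
    ultimately show ?thesis by argo
  qed
  have h0: "0 \<le> h l" for l unfolding h_def hellinger_vec_def by (intro sum_nonneg) auto
  have int: "integrable ?P (\<lambda>y. 2 * (W y - 1) + g y + 2 * pen l)"
    using intW g(1) by auto
  have "measure_pmf.expectation ?P (\<lambda>y. h (lhat y))
      \<le> measure_pmf.expectation ?P (\<lambda>y. 2 * (W y - 1) + g y + 2 * pen l)"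
    using int pw order_trans[OF h0 pw] by (intro integral_mono_AE') (auto simp: AE_measure_pmf_iff)
  also have "\<dots> = 2 * (measure_pmf.expectation ?P W - 1) + chi2_vec \<mu> (m l) + 2 * pen l"
    using intW g by simp
  also have "\<dots> \<le> chi2_vec \<mu> (m l) + 2 * pen l" using EW' by simp
  finally show ?thesis by (simp add: h_def)
qed

section \<open>From Hellinger distance to absolute error\<close>

text \<open>A difference of rates factors into sum and difference of their roots. Cauchy-Schwarz
  separates the factors, and the squared sum of the roots is at most twice the sum of the
  rates.\<close>

lemma sum_abs_diff_le_hellinger:
  assumes \<mu>: "\<mu> \<in> nonneg_vecs M" and \<nu>: "\<nu> \<in> nonneg_vecs M"
  shows "(\<Sum>j<M. \<bar>\<mu> $ j - \<nu> $ j\<bar>) \<le> sqrt (2 * (\<Sum>j<M. \<mu> $ j + \<nu> $ j)) * sqrt (hellinger_vec \<mu> \<nu>)"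
proof -
  have dim: "dim_vec \<mu> = M" and nn: "\<And>j. j < M \<Longrightarrow> 0 \<le> \<mu> $ j" "\<And>j. j < M \<Longrightarrow> 0 \<le> \<nu> $ j"
    using assms by (auto simp: nonneg_vecs_def)
  let ?p = "\<lambda>j. \<bar>sqrt (\<mu> $ j) + sqrt (\<nu> $ j)\<bar>" and ?m = "\<lambda>j. \<bar>sqrt (\<mu> $ j) - sqrt (\<nu> $ j)\<bar>"
  have "(\<Sum>j<M. \<bar>\<mu> $ j - \<nu> $ j\<bar>) = (\<Sum>j<M. ?p j * ?m j)"
  proof (rule sum.cong[OF refl])
    fix j assume "j \<in> {..<M}"
    then have "\<mu> $ j - \<nu> $ j = (sqrt (\<mu> $ j) + sqrt (\<nu> $ j)) * (sqrt (\<mu> $ j) - sqrt (\<nu> $ j))"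
      using nn by (simp add: square_diff_square_factored[symmetric])
    thus "\<bar>\<mu> $ j - \<nu> $ j\<bar> = ?p j * ?m j" by (simp only: abs_mult)
  qed
  also have "\<dots> \<le> sqrt ((\<Sum>j<M. (?p j)\<^sup>2) * (\<Sum>j<M. (?m j)\<^sup>2))"
    using Cauchy_Schwarz_ineq_sum[of ?p ?m "{..<M}"] by (intro real_le_rsqrt)
  also have "\<dots> \<le> sqrt (2 * (\<Sum>j<M. \<mu> $ j + \<nu> $ j) * hellinger_vec \<mu> \<nu>)"
  proof -
    have "(?p j)\<^sup>2 \<le> 2 * (\<mu> $ j + \<nu> $ j)" if "j < M" for j
      using nn[OF that] sum_squares_bound[of "sqrt (\<mu> $ j)" "sqrt (\<nu> $ j)"]
      by (simp add: power2_sum)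
    hence "(\<Sum>j<M. (?p j)\<^sup>2) \<le> 2 * (\<Sum>j<M. \<mu> $ j + \<nu> $ j)"
      unfolding sum_distrib_left by (intro sum_mono) auto
    thus ?thesis
      by (simp add: hellinger_vec_def dim mult_right_mono sum_nonneg)
  qed
  finally show ?thesis by (simp add: real_sqrt_mult)
qed

text \<open>This is the nonnegativity of the variance.\<close>

lemma expectation_le_sqrt:
  assumes "integrable (measure_pmf p) (\<lambda>y. (f y)\<^sup>2)" "integrable (measure_pmf p) f"
  shows "measure_pmf.expectation p f \<le> sqrt (measure_pmf.expectation p (\<lambda>y. (f y)\<^sup>2 :: real))"
  using measure_pmf.variance_positive[of p f] measure_pmf.variance_eq[OF assms(2,1)]
  by (intro real_le_rsqrt) simp

text \<open>Almost surely only finitely many values occur, so the function is bounded. It is applied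
  to the estimate, whose values lie in \<open>Lam\<close>.\<close>

lemma integrable_pmf_finite_range:
  fixes F :: "'b \<Rightarrow> real"
  assumes "finite \<Theta>" "\<And>y. y \<in> set_pmf p \<Longrightarrow> h y \<in> \<Theta>"
  shows "integrable (measure_pmf p) (\<lambda>y. F (h y))"
proof (rule measure_pmf.integrable_const_bound)
  show "AE y in measure_pmf p. norm (F (h y)) \<le> (\<Sum>l\<in>\<Theta>. \<bar>F l\<bar>)"
    using assms by (auto simp: AE_measure_pmf_iff intro!: member_le_sum)
qed simp

section \<open>Measurement error of the offset estimator\<close>

lemma adj_mat_mult_vec:
  assumes "v \<in> carrier_vec N" "j < M"
  shows "(adj_mat N M E *\<^sub>v v) $ j = (\<Sum>i | i < N \<and> (i, j) \<in> E. v $ i)"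
proof -
  have "(adj_mat N M E *\<^sub>v v) $ j = (\<Sum>i<N. if (i, j) \<in> E then v $ i else 0)"
    using assms by (auto simp: adj_mat_def scalar_prod_def atLeast0LessThan intro!: sum.cong)
  also have "\<dots> = (\<Sum>i\<in>{..<N} \<inter> {i. (i, j) \<in> E}. v $ i)" by (simp add: sum.inter_restrict)
  also have "{..<N} \<inter> {i. (i, j) \<in> E} = {i. i < N \<and> (i, j) \<in> E}" by auto
  finally show ?thesis .
qed

text \<open>Since \<open>s\<close> is nonzero, subtracting \<open>b\<close> and dividing by
  \<open>s\<close> undoes the offset map, so optimality over the offset class becomes optimality
  over \<open>Lam\<close>.\<close>

lemma is_pMLE_D:
  assumes "is_pMLE \<Phi> s b Lam pen y l" and "Lam \<subseteq> carrier_vec N" "b \<in> carrier_vec N" "s \<noteq> 0"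
  shows "l \<in> Lam"
    "l' \<in> Lam \<Longrightarrow> - ln (poisson_lik (\<Phi> *\<^sub>v (s \<cdot>\<^sub>v l + b)) y) + 2 * pen l
      \<le> - ln (poisson_lik (\<Phi> *\<^sub>v (s \<cdot>\<^sub>v l' + b)) y) + 2 * pen l'"
proof -
  have inv: "(1 / s) \<cdot>\<^sub>v ((s \<cdot>\<^sub>v l + b) - b) = l" if "l \<in> Lam" for l
  proof -
    have "l \<in> carrier_vec N" using that assms(2) by blast
    thus ?thesis using assms(3,4) by (intro eq_vecI) auto
  qed
  from assms(1) obtain f where f: "f \<in> offset_class s b Lam" "l = (1 / s) \<cdot>\<^sub>v (f - b)"
    and min: "\<And>g. g \<in> offset_class s b Lam \<Longrightarrow>
      - ln (poisson_lik (\<Phi> *\<^sub>v f) y) + 2 * pen ((1 / s) \<cdot>\<^sub>v (f - b))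
      \<le> - ln (poisson_lik (\<Phi> *\<^sub>v g) y) + 2 * pen ((1 / s) \<cdot>\<^sub>v (g - b))"
    unfolding is_pMLE_def is_arg_min_def by (auto simp: not_less)
  from f(1) obtain l0 where l0: "l0 \<in> Lam" "f = s \<cdot>\<^sub>v l0 + b" by (auto simp: offset_class_def)
  with f(2) inv have "l = l0" by simp
  with l0 show "l \<in> Lam" by simp
  show "- ln (poisson_lik (\<Phi> *\<^sub>v (s \<cdot>\<^sub>v l + b)) y) + 2 * pen l
      \<le> - ln (poisson_lik (\<Phi> *\<^sub>v (s \<cdot>\<^sub>v l' + b)) y) + 2 * pen l'" if "l' \<in> Lam"
    using min[of "s \<cdot>\<^sub>v l' + b"] that l0 inv \<open>l = l0\<close> by (simp add: offset_class_def)
qed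

text \<open>\<open>T\<close> is the observation time. The first term is the bias caused by the
  offset. The root comes from Cauchy-Schwarz: one factor bounds the total of true and model rates,
  the other is the Hellinger risk bound at the candidate \<open>l\<close>, both divided by
  \<open>T * real d\<close>.\<close>

lemma pMLE_measurement_error:
  fixes T c L0 :: real
  assumes EM: "E \<subseteq> {..<N} \<times> {..<M}" and deg: "\<And>i. i < N \<Longrightarrow> card (E `` {i}) = d" and d: "0 < d"
    and \<Omega>: "small_cover N M E \<Omega>"
    and pos: "0 < T" "0 < c" "0 < L0"
    and ls: "ls \<in> nonneg_vecs N" "l1_norm ls \<le> L0"
    and Lam: "finite Lam" "Lam \<subseteq> nonneg_vecs N" "\<And>l. l \<in> Lam \<Longrightarrow> l1_norm l \<le> L0"
    and kraft: "(\<Sum>l\<in>Lam. exp (- pen l)) \<le> 1"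
    and est: "\<And>y. y \<in> carrier_vec M \<Longrightarrow> is_pMLE ((1 / real d) \<cdot>\<^sub>m adj_mat N M E) (T * real d)
      ((c * (T * real d * L0)) \<cdot>\<^sub>v indicator_vec N \<Omega>) Lam pen y (lhat y)"
    and l: "l \<in> Lam"
  shows "measure_pmf.expectation (poisson_vec_pmf (T \<cdot>\<^sub>v (adj_mat N M E *\<^sub>v ls)))
      (\<lambda>y. \<Sum>j<M. \<bar>\<Sum>i | i < N \<and> (i, j) \<in> E. lhat y $ i - ls $ i\<bar>) / real d
    \<le> c * L0 * real M + sqrt (2 * L0 * (2 + c * real M) *
        (2 * real d * (l1_norm (ls - l))\<^sup>2 / (c * L0) + 2 * c * L0 * real M + 2 * pen l / (T * real d)))"
proof -
  let ?A = "adj_mat N M E"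
  define \<mu> where "\<mu> = T \<cdot>\<^sub>v (?A *\<^sub>v ls)"
  define b where "b = (c * (T * real d * L0)) \<cdot>\<^sub>v indicator_vec N \<Omega>"
  define m where "m l = ((1 / real d) \<cdot>\<^sub>m ?A) *\<^sub>v ((T * real d) \<cdot>\<^sub>v l + b)" for l
  define a where "a u j = (\<Sum>i | i < N \<and> (i, j) \<in> E. u $ i)" for u :: "real vec" and j
  \<comment> \<open>After division by \<open>d\<close>, each vertex of \<Omega> adds exactly
    \<open>q\<close> to the rate of every row it meets; \<beta> collects these
    contributions.\<close>
  define q where "q = c * T * L0"
  define \<beta> where "\<beta> j = q * real (card {i. i \<in> \<Omega> \<and> (i, j) \<in> E})" for j
  let ?P = "poisson_vec_pmf \<mu>"
  have q: "0 < q" using pos by (simp add: q_def)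
  have cover: "\<Omega> \<subseteq> {..<N}" "E `` \<Omega> = {..<M}" "card \<Omega> \<le> M"
    using \<Omega> by (auto simp: small_cover_def covers_def)
  have f\<Omega>: "finite \<Omega>" using cover(1) finite_subset by blast
  have LamC: "Lam \<subseteq> carrier_vec N" "ls \<in> carrier_vec N" and b: "b \<in> carrier_vec N"
    using Lam(2) ls(1) by (auto simp: nonneg_vecs_def b_def indicator_vec_def)
  have nn: "0 \<le> u $ i" if "u \<in> nonneg_vecs N" "i < N" for u i using that by (simp add: nonneg_vecs_def)
  have a0: "0 \<le> a u j" if "u \<in> nonneg_vecs N" for u j
    unfolding a_def using nn[OF that] by (intro sum_nonneg) auto
  have a_sum: "(\<Sum>j<M. a u j) = real d * (\<Sum>i<N. u $ i)" for u
  proof -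
    have "E `` {i} \<inter> {..<M} = E `` {i}" for i using EM by auto
    thus ?thesis
      unfolding a_def using sum_edges_swap[where S = "{..<N}" and B = "{..<M}" and E = E and y = "\<lambda>i. u $ i"]
      by (simp add: deg sum_distrib_left)
  qed
  have a_norm: "(\<Sum>j<M. a u j) = real d * l1_norm u" if "u \<in> nonneg_vecs N" for u
  proof -
    have "l1_norm u = (\<Sum>i<N. u $ i)"
      unfolding l1_norm_def using that nn[OF that]
      by (intro sum.cong) (auto simp: nonneg_vecs_def)
    thus ?thesis by (simp only: a_sum)
  qed
  have \<mu>_dim: "dim_vec \<mu> = M" by (simp add: \<mu>_def adj_mat_def)
  have m_dim: "dim_vec (m l) = M" for l by (simp add: m_def adj_mat_def)
  have \<mu>_j: "\<mu> $ j = T * a ls j" if "j < M" for j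
    using that adj_mat_mult_vec[OF LamC(2) that, of E] by (simp add: \<mu>_def a_def adj_mat_def)
  have m_j: "m l $ j = T * a l j + \<beta> j" if "l \<in> Lam" "j < M" for l j
  proof -
    have lc: "l \<in> carrier_vec N" using that LamC by blast
    have "((1 / real d) \<cdot>\<^sub>m ?A) *\<^sub>v ((T * real d) \<cdot>\<^sub>v l + b) = (1 / real d) \<cdot>\<^sub>v (?A *\<^sub>v ((T * real d) \<cdot>\<^sub>v l + b))"
      using lc b by (intro eq_vecI) (auto simp: adj_mat_def)
    hence "m l $ j = (\<Sum>i | i < N \<and> (i, j) \<in> E. ((T * real d) \<cdot>\<^sub>v l + b) $ i) / real d"
      using adj_mat_mult_vec[of "(T * real d) \<cdot>\<^sub>v l + b" N j M E] lc b that
      by (simp add: m_def adj_mat_def)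
    also have "(\<Sum>i | i < N \<and> (i, j) \<in> E. ((T * real d) \<cdot>\<^sub>v l + b) $ i)
        = (\<Sum>i | i < N \<and> (i, j) \<in> E. T * real d * l $ i + q * real d * indicator \<Omega> i)"
      using lc by (intro sum.cong) (auto simp: b_def indicator_vec_def q_def)
    also have "\<dots> = T * real d * a l j + q * real d * (\<Sum>i | i < N \<and> (i, j) \<in> E. indicator \<Omega> i)"
      by (simp add: a_def sum.distrib sum_distrib_left)
    also have "(\<Sum>i | i < N \<and> (i, j) \<in> E. indicator \<Omega> i :: real) = real (card {i. i \<in> \<Omega> \<and> (i, j) \<in> E})"
    proof -
      have "{i. i < N \<and> (i, j) \<in> E} \<inter> \<Omega> = {i. i \<in> \<Omega> \<and> (i, j) \<in> E}" using cover(1) by auto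
      thus ?thesis by (simp add: indicator_def sum.If_cases Int_def)
    qed
    finally show ?thesis using d by (simp add: \<beta>_def add_divide_distrib)
  qed
  \<comment> \<open>The covering property puts a floor \<open>q\<close> under every model
    rate.\<close>
  have \<beta>_ge: "q \<le> \<beta> j" if "j < M" for j
  proof -
    have "{i. i \<in> \<Omega> \<and> (i, j) \<in> E} \<noteq> {}" using cover(2) that by auto
    hence "1 \<le> card {i. i \<in> \<Omega> \<and> (i, j) \<in> E}" using f\<Omega> by (simp add: card_gt_0_iff Suc_le_eq)
    thus ?thesis using q by (simp add: \<beta>_def)
  qed
  \<comment> \<open>Double counting: at most \<open>M\<close> vertices of \<Omega> each add
    \<open>q\<close> to \<open>d\<close> rows.\<close>
  have \<beta>_sum: "(\<Sum>j<M. \<beta> j) \<le> q * real d * real M"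
  proof -
    have E: "E `` {i} \<inter> {..<M} = E `` {i}" for i using EM by auto
    have "(\<Sum>j<M. real (card {i. i \<in> \<Omega> \<and> (i, j) \<in> E})) = (\<Sum>i\<in>\<Omega>. real (card (E `` {i})))"
      using sum_edges_swap[where S = \<Omega> and B = "{..<M}" and E = E and y = "\<lambda>_. 1"] f\<Omega> by (simp add: E)
    also have "\<dots> = real d * real (card \<Omega>)" using deg cover(1) by (simp add: subset_iff)
    also have "\<dots> \<le> real d * real M" using cover(3) by (intro mult_left_mono) auto
    finally have "q * (\<Sum>j<M. real (card {i. i \<in> \<Omega> \<and> (i, j) \<in> E})) \<le> q * (real d * real M)"
      using q by (intro mult_left_mono) auto
    thus ?thesis by (simp add: \<beta>_def sum_distrib_left mult.assoc)
  qed
  have m_pos: "0 < m l $ j" if "l \<in> Lam" "j < M" for l j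
  proof -
    have "0 \<le> T * a l j" using a0[of l j] that(1) Lam(2) pos(1) by auto
    with m_j[OF that] \<beta>_ge[OF that(2)] q show ?thesis by linarith
  qed
  have \<mu>: "\<mu> \<in> nonneg_vecs M"
    unfolding nonneg_vecs_def using \<mu>_j a0[OF ls(1)] pos(1) by (simp add: carrier_vecI[OF \<mu>_dim])
  have mC: "m l \<in> carrier_vec M" for l by (rule carrier_vecI[OF m_dim])
  have mN: "m l \<in> nonneg_vecs M" if "l \<in> Lam" for l
    unfolding nonneg_vecs_def using m_pos[OF that] by (simp add: mC less_imp_le)
  have sd: "T * real d \<noteq> 0" using pos d by simp
  note pm = is_pMLE_D[OF est[folded b_def] LamC(1) b sd, folded m_def]
  have supp: "lhat y \<in> Lam" if "y \<in> set_pmf ?P" for y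
    using that set_pmf_poisson_vec[of \<mu>] pm(1) \<mu>_dim by auto
  define K where "K = chi2_vec \<mu> (m l) + 2 * pen l"
  have H: "measure_pmf.expectation ?P (\<lambda>y. hellinger_vec \<mu> (m (lhat y))) \<le> K"
    unfolding K_def
    by (rule penalized_mle_hellinger_bound[OF \<mu> Lam(1) mC m_pos kraft pm(1) pm(2) l])
  define \<Delta> where "\<Delta> = l1_norm (ls - l)"
  have "chi2_vec \<mu> (m l) \<le> (\<Sum>j<M. 2 * (T * (a ls j - a l j))\<^sup>2 / q + 2 * \<beta> j)"
    unfolding chi2_vec_def \<mu>_dim
  proof (rule sum_mono)
    fix j assume "j \<in> {..<M}"
    then have j: "j < M" by simp
    define x where "x = T * (a ls j - a l j)"
    have \<nu>: "m l $ j \<ge> \<beta> j" "m l $ j \<ge> q" "0 < \<beta> j"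
    proof -
      have "0 \<le> T * a l j" using a0[of l j] l Lam(2) pos(1) by auto
      with m_j[OF l j] \<beta>_ge[OF j] q show "m l $ j \<ge> \<beta> j" "m l $ j \<ge> q" "0 < \<beta> j" by linarith+
    qed
    have "\<mu> $ j - m l $ j = x - \<beta> j" using m_j[OF l j] \<mu>_j[OF j] by (simp add: x_def algebra_simps)
    hence "(\<mu> $ j - m l $ j)\<^sup>2 \<le> 2 * x\<^sup>2 + 2 * (\<beta> j)\<^sup>2"
      using sum_squares_bound[of x "- \<beta> j"] by (simp add: power2_diff)
    hence "(\<mu> $ j - m l $ j)\<^sup>2 / m l $ j \<le> (2 * x\<^sup>2) / m l $ j + (2 * (\<beta> j)\<^sup>2) / m l $ j"
      using \<nu> q by (simp add: add_divide_distrib[symmetric] divide_right_mono)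
    \<comment> \<open>The two lower bounds for the model rate are used separately: \<open>q\<close>
      under the approximation error, and \<open>\<beta> j\<close> under the squared offset, which
      leaves a term linear in the offset.\<close>
    also have "\<dots> \<le> (2 * x\<^sup>2) / q + (2 * (\<beta> j)\<^sup>2) / \<beta> j"
      using \<nu> q by (intro add_mono divide_left_mono) auto
    also have "(2 * (\<beta> j)\<^sup>2) / \<beta> j = 2 * \<beta> j" using \<nu> by (simp add: power2_eq_square)
    finally show "(\<mu> $ j - m l $ j)\<^sup>2 / m l $ j \<le> 2 * (T * (a ls j - a l j))\<^sup>2 / q + 2 * \<beta> j"
      by (simp add: x_def)
  qed
  also have "\<dots> = 2 * T\<^sup>2 / q * (\<Sum>j<M. (a ls j - a l j)\<^sup>2) + 2 * (\<Sum>j<M. \<beta> j)"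
    by (simp add: sum.distrib sum_distrib_left power_mult_distrib mult.assoc)
  also have "\<dots> \<le> 2 * T\<^sup>2 / q * (real d * \<Delta>)\<^sup>2 + 2 * (q * real d * real M)"
  proof -
    have lc: "l \<in> carrier_vec N" using l LamC by blast
    have "(\<Sum>j<M. (a ls j - a l j)\<^sup>2) = (\<Sum>j<M. \<bar>a ls j - a l j\<bar> * \<bar>a ls j - a l j\<bar>)"
      by (simp add: power2_eq_square)
    also have "\<dots> \<le> (\<Sum>j<M. \<bar>a ls j - a l j\<bar> * (\<Sum>j<M. \<bar>a ls j - a l j\<bar>))"
      by (intro sum_mono mult_left_mono member_le_sum) auto
    also have "\<dots> = (\<Sum>j<M. \<bar>a ls j - a l j\<bar>)\<^sup>2"
      by (simp add: power2_eq_square sum_distrib_right)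
    also have "\<dots> \<le> (real d * \<Delta>)\<^sup>2"
    proof (rule power_mono)
      have "\<bar>a ls j - a l j\<bar> \<le> a (vec N (\<lambda>i. \<bar>ls $ i - l $ i\<bar>)) j" for j
        unfolding a_def sum_subtractf[symmetric] by (rule order_trans[OF sum_abs]) simp
      hence "(\<Sum>j<M. \<bar>a ls j - a l j\<bar>) \<le> (\<Sum>j<M. a (vec N (\<lambda>i. \<bar>ls $ i - l $ i\<bar>)) j)"
        by (rule sum_mono)
      also have "\<dots> = real d * \<Delta>"
        unfolding a_sum \<Delta>_def l1_norm_def using lc LamC by simp
      finally show "(\<Sum>j<M. \<bar>a ls j - a l j\<bar>) \<le> real d * \<Delta>" .
    qed (simp add: sum_nonneg)
    finally have "(\<Sum>j<M. (a ls j - a l j)\<^sup>2) \<le> (real d * \<Delta>)\<^sup>2" .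
    thus ?thesis using \<beta>_sum q by (intro add_mono mult_left_mono) auto
  qed
  finally have K: "K \<le> 2 * T\<^sup>2 / q * (real d * \<Delta>)\<^sup>2 + 2 * (q * real d * real M) + 2 * pen l"
    by (simp add: K_def)

  define B where "B = T * real d * L0 * (2 + c * real M)"
  have B0: "0 \<le> B" using pos by (simp add: B_def)
  have total: "(\<Sum>j<M. \<mu> $ j + m l $ j) \<le> B" if "l \<in> Lam" for l
  proof -
    have "(\<Sum>j<M. \<mu> $ j + m l $ j) = (\<Sum>j<M. T * a ls j + T * a l j + \<beta> j)"
      using m_j[OF that] \<mu>_j by (intro sum.cong) auto
    also have "\<dots> = T * (\<Sum>j<M. a ls j) + T * (\<Sum>j<M. a l j) + (\<Sum>j<M. \<beta> j)"
      by (simp add: sum.distrib sum_distrib_left)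
    also have "\<dots> \<le> T * (real d * L0) + T * (real d * L0) + q * real d * real M"
    proof -
      have "l \<in> nonneg_vecs N" using that Lam(2) by blast
      with Lam(3)[OF that] ls(2) have "(\<Sum>j<M. a ls j) \<le> real d * L0" "(\<Sum>j<M. a l j) \<le> real d * L0"
        by (simp_all add: a_norm[OF ls(1)] a_norm mult_left_mono)
      with \<beta>_sum pos(1) show ?thesis by (intro add_mono mult_left_mono) auto
    qed
    finally show ?thesis by (simp add: B_def q_def algebra_simps)
  qed
  define R where "R l = (\<Sum>j<M. \<bar>\<Sum>i | i < N \<and> (i, j) \<in> E. l $ i - ls $ i\<bar>)" for l
  define h where "h l = sqrt (hellinger_vec \<mu> (m l))" for l
  have hell0: "0 \<le> hellinger_vec \<mu> \<nu>" for \<nu> by (simp add: hellinger_vec_def sum_nonneg)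
  have R_le: "T * R l \<le> sqrt (2 * B) * h l + q * real d * real M" if "l \<in> Lam" for l
  proof -
    have "R l = (\<Sum>j<M. \<bar>a l j - a ls j\<bar>)" by (simp add: R_def a_def sum_subtractf)
    hence "T * R l = (\<Sum>j<M. \<bar>T * a l j - T * a ls j\<bar>)"
      using pos(1) by (simp add: sum_distrib_left abs_mult right_diff_distrib[symmetric])
    also have "\<dots> \<le> (\<Sum>j<M. \<bar>\<mu> $ j - m l $ j\<bar> + \<beta> j)"
    proof (rule sum_mono)
      fix j assume "j \<in> {..<M}"
      then have j: "j < M" by simp
      show "\<bar>T * a l j - T * a ls j\<bar> \<le> \<bar>\<mu> $ j - m l $ j\<bar> + \<beta> j"
        using m_j[OF that j] \<mu>_j[OF j] \<beta>_ge[OF j] q by linarith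
    qed
    also have "\<dots> \<le> sqrt (2 * (\<Sum>j<M. \<mu> $ j + m l $ j)) * h l + q * real d * real M"
      unfolding sum.distrib[of "\<lambda>j. \<bar>\<mu> $ j - m l $ j\<bar>"] h_def
      by (intro add_mono sum_abs_diff_le_hellinger[OF \<mu> mN[OF that]] \<beta>_sum)
    also have "\<dots> \<le> sqrt (2 * B) * h l + q * real d * real M"
      using total[OF that] by (intro add_mono mult_right_mono) (auto simp: h_def hell0)
    finally show ?thesis .
  qed
  note int = integrable_pmf_finite_range[where p = ?P and h = lhat, OF Lam(1) supp]
  have "T * measure_pmf.expectation ?P (\<lambda>y. R (lhat y)) = measure_pmf.expectation ?P (\<lambda>y. T * R (lhat y))"
    by simp
  also have "\<dots> \<le> measure_pmf.expectation ?P (\<lambda>y. sqrt (2 * B) * h (lhat y) + q * real d * real M)"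
    using R_le supp by (intro integral_mono_AE int) (auto simp: AE_measure_pmf_iff)
  also have "\<dots> = sqrt (2 * B) * measure_pmf.expectation ?P (\<lambda>y. h (lhat y)) + q * real d * real M"
    using int[of h] by simp
  also have "measure_pmf.expectation ?P (\<lambda>y. h (lhat y)) \<le> sqrt (measure_pmf.expectation ?P (\<lambda>y. (h (lhat y))\<^sup>2))"
    by (rule expectation_le_sqrt[OF int[of "\<lambda>l. (h l)\<^sup>2"] int[of h]])
  also have "\<dots> \<le> sqrt K" using H by (simp add: h_def hell0)
  also have "sqrt (2 * B) * sqrt K = sqrt (2 * B * K)" by (simp add: real_sqrt_mult)
  finally have "T * measure_pmf.expectation ?P (\<lambda>y. R (lhat y)) \<le> sqrt (2 * B * K) + q * real d * real M"
    using B0 by (simp add: mult_left_mono)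
  hence "measure_pmf.expectation ?P (\<lambda>y. R (lhat y)) / real d
      \<le> (sqrt (2 * B * K) + q * real d * real M) / (T * real d)"
    using pos d by (simp add: field_simps)
  also have "\<dots> = sqrt (2 * B * K) / (T * real d) + c * L0 * real M"
    using pos d by (simp add: q_def field_simps)
  also have "sqrt (2 * B * K) / (T * real d) = sqrt (2 * B * K / (T * real d)\<^sup>2)"
    using pos d by (simp add: real_sqrt_divide)
  also have "\<dots> \<le> sqrt (2 * L0 * (2 + c * real M) *
        (2 * real d * \<Delta>\<^sup>2 / (c * L0) + 2 * c * L0 * real M + 2 * pen l / (T * real d)))"
  proof (rule real_sqrt_le_mono)
    have "2 * B * K / (T * real d)\<^sup>2
        \<le> 2 * B * (2 * T\<^sup>2 / q * (real d * \<Delta>)\<^sup>2 + 2 * (q * real d * real M) + 2 * pen l) / (T * real d)\<^sup>2"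
      using K B0 by (intro divide_right_mono mult_left_mono) auto
    also have "\<dots> = 2 * L0 * (2 + c * real M) *
        (2 * real d * \<Delta>\<^sup>2 / (c * L0) + 2 * c * L0 * real M + 2 * pen l / (T * real d))"
    proof -
      \<comment> \<open>One factor \<open>T * real d\<close> of the square normalizes the total
        rate, the other the risk bound.\<close>
      have split: "2 * B * X / (T * real d)\<^sup>2 = 2 * B / (T * real d) * (X / (T * real d))" for X
        by (simp add: power2_eq_square)
      have "2 * B / (T * real d) = 2 * L0 * (2 + c * real M)" using pos d by (simp add: B_def)
      moreover have "(2 * T\<^sup>2 / q * (real d * \<Delta>)\<^sup>2 + 2 * (q * real d * real M) + 2 * pen l) / (T * real d)
          = 2 * real d * \<Delta>\<^sup>2 / (c * L0) + 2 * c * L0 * real M + 2 * pen l / (T * real d)"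
        using pos d by (simp add: q_def add_divide_distrib power_mult_distrib power2_eq_square)
      ultimately show ?thesis by (simp only: split)
    qed
    finally show "2 * B * K / (T * real d)\<^sup>2 \<le> 2 * L0 * (2 + c * real M) *
        (2 * real d * \<Delta>\<^sup>2 / (c * L0) + 2 * c * L0 * real M + 2 * pen l / (T * real d))" .
  qed
  finally show ?thesis unfolding R_def \<mu>_def \<Delta>_def by simp
qed

section \<open>The error rate\<close>

lemma l1_norm_triangle:
  assumes "u \<in> carrier_vec N" "v \<in> carrier_vec N"
  shows "l1_norm (u - v) \<le> l1_norm u + l1_norm v"
  using assms by (simp add: l1_norm_def sum.distrib[symmetric] sum_mono abs_triangle_ineq4)

text \<open>A set of largest coordinates exists once \<open>k\<close> is at most the dimension, so
  the choice in \<open>sigma_k\<close> is meaningful.\<close>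

lemma sigma_k_eq:
  assumes "k \<le> dim_vec u"
  obtains S where "S \<subseteq> {..<dim_vec u}" "card S = k" "sigma_k k u = (\<Sum>i\<in>{..<dim_vec u} - S. \<bar>u $ i\<bar>)"
proof -
  have "\<exists>S. largest_coords k u S"
    using ex_top_subset[of "{..<dim_vec u}" k "\<lambda>i. \<bar>u $ i\<bar>"] assms by (auto simp: largest_coords_def)
  then have "largest_coords k u (SOME S. largest_coords k u S)" by (rule someI_ex)
  with that show ?thesis by (auto simp: largest_coords_def sigma_k_def)
qed

text \<open>Applied to \<open>N / k\<close>, which is at least 2; the lower bound lets constants be
  absorbed into powers of the logarithm.\<close>

lemma half_le_ln:
  fixes x :: real
  assumes "2 \<le> x"
  shows "1 / 2 \<le> ln x"
proof -
  have "ln (1 / 2 :: real) \<le> 1 / 2 - 1" by (rule ln_le_minus_one) simp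
  moreover have "ln 2 \<le> ln x" using assms by simp
  ultimately show ?thesis by (simp add: ln_div)
qed

text \<open>Applied with \<open>ell = ln (N / k)\<close>, \<open>\<Delta> = ||\<lambda>\<^sup>* - l||\<^sub>1\<close> and \<open>p = pen l\<close>.\<close>

lemma measurement_error_rate:
  fixes k ell \<gamma> c d M C1 C2 L0 \<Delta> p T :: real
  assumes k: "1 \<le> k" and ell: "1 / 2 \<le> ell" and \<gamma>: "0 < \<gamma>" "\<gamma> < 1" and c: "c = \<gamma> / (k * ell)"
    and d: "1 \<le> d" "d \<le> C1 * ell" and M: "0 \<le> M" "M \<le> C2 * (k * ell)" and C2: "0 \<le> C2"
    and L0: "0 < L0" and p: "0 \<le> p" and T: "0 < T"
  shows "c * L0 * M + sqrt (2 * L0 * (2 + c * M) *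
      (2 * d * \<Delta>\<^sup>2 / (c * L0) + 2 * c * L0 * M + 2 * p / (T * d)))
    \<le> (2 * C2 * L0 + 2 * sqrt (4 * L0\<^sup>2 * C2 * (2 + C2))) * (sqrt (\<gamma> * k) * ell)
      + sqrt ((4 * C1 + 16 * L0) * (2 + C2)) * (ell * sqrt (k / \<gamma> * (\<Delta>\<^sup>2 + p / T)))"
proof -
  have kl: "0 < k * ell" using k ell by simp
  have c0: "0 < c" using c \<gamma> kl by simp
  have "0 < C1 * ell" using d by linarith
  hence C1: "0 < C1" using ell by (simp add: zero_less_mult_iff)
  have "c * M \<le> c * (C2 * (k * ell))" using M c0 by (intro mult_left_mono) auto
  also have "\<dots> = C2 * \<gamma>" using k ell by (simp add: c)
  finally have cM: "c * M \<le> C2 * \<gamma>" .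
  have cM0: "0 \<le> c * M" using c0 M by simp
  have "C2 * \<gamma> \<le> C2 * 1" using \<gamma> C2 by (intro mult_left_mono) auto
  with cM have cM2: "2 + c * M \<le> 2 + C2" by simp
  define s where "s = sqrt (\<gamma> * k) * ell"
  have s0: "0 \<le> s" using \<gamma> k ell by (simp add: s_def)
  \<comment> \<open>The factor 2 compensates for \<open>ell\<close> being only known to be at least
    one half.\<close>
  have root: "sqrt \<gamma> \<le> 2 * s"
  proof -
    have "sqrt \<gamma> * 1 * 1 \<le> sqrt \<gamma> * sqrt k * (2 * ell)"
      using \<gamma> k ell by (intro mult_mono) auto
    thus ?thesis by (simp add: s_def real_sqrt_mult mult_ac)
  qed
  have "\<gamma> = sqrt \<gamma> * sqrt \<gamma>" using \<gamma> by simp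
  also have "\<dots> \<le> sqrt \<gamma> * 1" using \<gamma> by (intro mult_left_mono) auto
  finally have \<gamma>s: "\<gamma> \<le> 2 * s" using root by simp

  \<comment> \<open>\<open>Y\<close> is the common amplification inside the root of the target rate.
    The approximation term meets it through \<open>d / c \<le> C1 * Y\<close>; the penalty term,
    which lacks it, is enlarged using \<open>1 \<le> 4 * Y\<close>.\<close>
  define Y where "Y = k * ell\<^sup>2 / \<gamma>"
  have Y: "1 / 4 \<le> Y"
  proof -
    have "(1 / 2)\<^sup>2 \<le> ell\<^sup>2" using ell by (intro power_mono) auto
    hence "1 * (1 / 4) \<le> k * ell\<^sup>2" using k by (intro mult_mono) (auto simp: power2_eq_square)
    also have "\<dots> \<le> Y" using \<gamma> kl k unfolding Y_def by (simp add: le_divide_eq mult_left_le)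
    finally show ?thesis by simp
  qed
  have 1: "d * \<Delta>\<^sup>2 / c \<le> C1 * (Y * \<Delta>\<^sup>2)"
  proof -
    have "d * \<Delta>\<^sup>2 / c = d * (\<Delta>\<^sup>2 / c)" by simp
    also have "\<dots> \<le> (C1 * ell) * (\<Delta>\<^sup>2 / c)" using d c0 by (intro mult_right_mono) auto
    also have "\<dots> = C1 * (Y * \<Delta>\<^sup>2)" using c by (simp add: Y_def power2_eq_square)
    finally show ?thesis .
  qed
  have 2: "p / (T * d) \<le> 4 * (Y * (p / T))"
  proof -
    have "p / (T * d) \<le> p / (T * 1)" using d T p by (intro divide_left_mono mult_left_mono) auto
    also have "\<dots> \<le> (4 * Y) * (p / T)" using mult_right_mono[of 1 "4 * Y" "p / T"] Y p T by simp
    finally show ?thesis by simp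
  qed
  let ?X = "\<Delta>\<^sup>2 + p / T"
  have X0: "0 \<le> Y * \<Delta>\<^sup>2" "0 \<le> Y * (p / T)" using Y p T by auto
  have "2 * L0 * (2 + c * M) * (2 * d * \<Delta>\<^sup>2 / (c * L0) + 2 * c * L0 * M + 2 * p / (T * d))
      = (2 + c * M) * (4 * (d * \<Delta>\<^sup>2 / c) + 4 * L0\<^sup>2 * (c * M) + 4 * L0 * (p / (T * d)))"
    using L0 c0 by (simp add: power2_eq_square distrib_left add_divide_distrib mult_ac)
  also have "\<dots> \<le> (2 + C2) * (4 * (C1 * (Y * \<Delta>\<^sup>2)) + 4 * L0\<^sup>2 * (C2 * \<gamma>) + 4 * L0 * (4 * (Y * (p / T))))"
  proof (rule mult_mono[OF cM2])
    show "4 * (d * \<Delta>\<^sup>2 / c) + 4 * L0\<^sup>2 * (c * M) + 4 * L0 * (p / (T * d))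
        \<le> 4 * (C1 * (Y * \<Delta>\<^sup>2)) + 4 * L0\<^sup>2 * (C2 * \<gamma>) + 4 * L0 * (4 * (Y * (p / T)))"
      using L0 by (intro add_mono mult_left_mono 1 2 cM) auto
    show "0 \<le> 4 * (d * \<Delta>\<^sup>2 / c) + 4 * L0\<^sup>2 * (c * M) + 4 * L0 * (p / (T * d))"
      using cM0 L0 d c0 p T
      by (intro add_nonneg_nonneg mult_nonneg_nonneg[OF _ cM0] mult_nonneg_nonneg[OF _ divide_nonneg_nonneg]) auto
  qed (use C2 in simp)
  also have "\<dots> \<le> (2 + C2) * ((4 * C1 + 16 * L0) * (Y * ?X) + 4 * L0\<^sup>2 * C2 * \<gamma>)"
  proof (rule mult_left_mono)
    have "4 * (C1 * a) + 4 * L0\<^sup>2 * (C2 * \<gamma>) + 4 * L0 * (4 * b)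
        \<le> (4 * C1 + 16 * L0) * (a + b) + 4 * L0\<^sup>2 * C2 * \<gamma>" if "0 \<le> a" "0 \<le> b" for a b
    proof -
      have "0 \<le> L0 * a" "0 \<le> C1 * b" using that C1 L0 by auto
      thus ?thesis by (simp add: algebra_simps)
    qed
    from this[OF X0] show "4 * (C1 * (Y * \<Delta>\<^sup>2)) + 4 * L0\<^sup>2 * (C2 * \<gamma>) + 4 * L0 * (4 * (Y * (p / T)))
        \<le> (4 * C1 + 16 * L0) * (Y * ?X) + 4 * L0\<^sup>2 * C2 * \<gamma>"
      by (simp only: distrib_left[of Y])
  qed (use C2 in simp)
  also have "\<dots> = (4 * C1 + 16 * L0) * (2 + C2) * (Y * ?X) + 4 * L0\<^sup>2 * C2 * (2 + C2) * \<gamma>"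
    unfolding distrib_left[of "2 + C2" "(4 * C1 + 16 * L0) * (Y * ?X)"] by (simp only: mult_ac)
  finally have "sqrt (2 * L0 * (2 + c * M) * (2 * d * \<Delta>\<^sup>2 / (c * L0) + 2 * c * L0 * M + 2 * p / (T * d)))
      \<le> sqrt ((4 * C1 + 16 * L0) * (2 + C2) * (Y * ?X) + 4 * L0\<^sup>2 * C2 * (2 + C2) * \<gamma>)"
    by (rule real_sqrt_le_mono)
  also have "\<dots> \<le> sqrt ((4 * C1 + 16 * L0) * (2 + C2) * (Y * ?X)) + sqrt (4 * L0\<^sup>2 * C2 * (2 + C2) * \<gamma>)"
    using C1 C2 L0 Y p T \<gamma> by (intro sqrt_add_le_add_sqrt mult_nonneg_nonneg add_nonneg_nonneg) auto
  also have "sqrt ((4 * C1 + 16 * L0) * (2 + C2) * (Y * ?X))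
      = sqrt ((4 * C1 + 16 * L0) * (2 + C2)) * (ell * sqrt (k / \<gamma> * ?X))"
  proof -
    have "Y * ?X = ell\<^sup>2 * (k / \<gamma> * ?X)" by (simp add: Y_def)
    hence "sqrt (Y * ?X) = ell * sqrt (k / \<gamma> * ?X)"
      using ell by (simp only: real_sqrt_mult[of "ell\<^sup>2"] real_sqrt_abs)
    thus ?thesis by (simp only: real_sqrt_mult[of "(4 * C1 + 16 * L0) * (2 + C2)"])
  qed
  also have "sqrt (4 * L0\<^sup>2 * C2 * (2 + C2) * \<gamma>) \<le> sqrt (4 * L0\<^sup>2 * C2 * (2 + C2)) * (2 * s)"
    unfolding real_sqrt_mult[of _ \<gamma>] using root C2 by (intro mult_left_mono) auto
  finally have "sqrt (2 * L0 * (2 + c * M) * (2 * d * \<Delta>\<^sup>2 / (c * L0) + 2 * c * L0 * M + 2 * p / (T * d)))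
      \<le> sqrt ((4 * C1 + 16 * L0) * (2 + C2)) * (ell * sqrt (k / \<gamma> * ?X))
        + sqrt (4 * L0\<^sup>2 * C2 * (2 + C2)) * (2 * s)"
    by simp
  moreover have "c * L0 * M \<le> 2 * C2 * L0 * s"
  proof -
    have "c * L0 * M = L0 * (c * M)" by simp
    also have "\<dots> \<le> L0 * (C2 * (2 * s))"
      using cM \<gamma>s C2 L0 by (intro mult_left_mono) (auto intro: order_trans mult_left_mono)
    finally show ?thesis by (simp add: mult_ac)
  qed
  ultimately show ?thesis by (simp add: s_def algebra_simps)
qed

text \<open>The constant precedes all other quantifiers, which makes the O-terms uniform: it may
  depend only on \<open>L0\<close> and on \<open>C1\<close>, \<open>C2\<close>, the constants hidden
  in the sizes of the expander. Minimizers need not be unique, so \<open>lhat\<close> is any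
  selection of them.\<close>

theorem theorem5:
  fixes L0 C1 C2 :: real
  assumes "L0 > 0"
  shows "\<exists>C>0. \<forall>(N::nat) (M::nat) (k::nat) (d::nat) (n::nat) (\<tau>::real) (\<gamma>::real) (c::real) (L::real)
      (E::(nat \<times> nat) set) (A::real mat) (\<Omega>::nat set)
      (ls::real vec) (Lam::real vec set) (pen::real vec \<Rightarrow> real) (lhat::nat vec \<Rightarrow> real vec).
    1 \<le> k \<and> real k \<le> real N / 2 \<and> \<tau> > 0 \<and> n \<ge> 1 \<and>
    expander N M E d (max k 2) (1 / 16) \<and> d > 0 \<and>
    real d \<le> C1 * ln (real N / real k) \<and>
    real M \<le> C2 * (real k * ln (real N / real k)) \<and>
    A = adj_mat N M E \<and>
    small_cover N M E \<Omega> \<and>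
    ls \<in> nonneg_vecs N \<and> l1_norm ls \<le> L0 \<and>
    finite Lam \<and> Lam \<noteq> {} \<and> Lam \<subseteq> nonneg_vecs N \<and> (\<forall>l\<in>Lam. l1_norm l \<le> L0) \<and>
    (\<forall>l\<in>Lam. pen l \<ge> 0) \<and> (\<Sum>l\<in>Lam. exp (- pen l)) \<le> 1 \<and>
    \<gamma> > 0 \<and> c = \<gamma> / (real k * ln (real N / real k)) \<and> c < 1 \<and>
    L = real n * \<tau> * real d * L0 \<and>
    (\<forall>y\<in>carrier_vec M.
       is_pMLE ((1 / real d) \<cdot>\<^sub>m A) (real n * \<tau> * real d) ((c * L) \<cdot>\<^sub>v indicator_vec N \<Omega>)
         Lam pen y (lhat y))
    \<longrightarrow>
    measure_pmf.expectation (poisson_vec_pmf ((real n * \<tau>) \<cdot>\<^sub>v (A *\<^sub>v ls)))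
        (\<lambda>y. l1_norm (lhat y - ls))
      \<le> C * (sigma_k k ls + sqrt (\<gamma> * real k) * ln (real N / real k))
        + C * (ln (real N / real k) *
            sqrt (real k / \<gamma> * (MIN l\<in>Lam. (l1_norm (ls - l))\<^sup>2 + pen l / (real n * \<tau>))))"
proof -
  \<comment> \<open>Moduli are taken because the signs of \<open>C1\<close> and \<open>C2\<close>
    are not prescribed, while the rate estimate works with a nonnegative size constant.\<close>
  define D where "D = \<bar>C2\<bar>"
  define G1 where "G1 = 2 * D * L0 + 2 * sqrt (4 * L0\<^sup>2 * D * (2 + D))"
  define G2 where "G2 = sqrt ((4 * \<bar>C1\<bar> + 16 * L0) * (2 + D))"
  \<comment> \<open>7 and 12 are the stability constants of the expander; \<open>4 * L0\<close>
    serves the case \<open>\<gamma> \<ge> 1\<close>.\<close>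
  define C where "C = 7 + 12 * G1 + 12 * G2 + 4 * L0"
  have G: "0 \<le> G1" "0 \<le> G2" using assms by (auto simp: G1_def G2_def D_def)
  have C: "0 < C" "7 \<le> C" "12 * G1 \<le> C" "12 * G2 \<le> C" "4 * L0 \<le> C" using G assms by (auto simp: C_def)
  show ?thesis
  proof (rule exI[of _ C], intro conjI C(1) allI impI, elim conjE)
    fix N M k d n :: nat and \<tau> \<gamma> c L :: real and E :: "(nat \<times> nat) set" and A :: "real mat"
      and \<Omega> :: "nat set" and ls :: "real vec" and Lam :: "real vec set"
      and pen :: "real vec \<Rightarrow> real" and lhat :: "nat vec \<Rightarrow> real vec"
    assume k: "1 \<le> k" "real k \<le> real N / 2" and \<tau>: "\<tau> > 0" and n: "n \<ge> 1"
      and expand: "expander N M E d (max k 2) (1 / 16)" and d: "d > 0"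
      and dC1: "real d \<le> C1 * ln (real N / real k)"
      and MC2: "real M \<le> C2 * (real k * ln (real N / real k))"
      and A: "A = adj_mat N M E" and cover: "small_cover N M E \<Omega>"
      and ls: "ls \<in> nonneg_vecs N" "l1_norm ls \<le> L0"
      and Lam: "finite Lam" "Lam \<noteq> {}" "Lam \<subseteq> nonneg_vecs N" "\<forall>l\<in>Lam. l1_norm l \<le> L0"
      and pen: "\<forall>l\<in>Lam. pen l \<ge> 0" and kraft: "(\<Sum>l\<in>Lam. exp (- pen l)) \<le> 1"
      and \<gamma>: "\<gamma> > 0" and c: "c = \<gamma> / (real k * ln (real N / real k))"
      and L: "L = real n * \<tau> * real d * L0"
      and est: "\<forall>y\<in>carrier_vec M. is_pMLE ((1 / real d) \<cdot>\<^sub>m A) (real n * \<tau> * real d)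
        ((c * L) \<cdot>\<^sub>v indicator_vec N \<Omega>) Lam pen y (lhat y)"
    define T where "T = real n * \<tau>"
    define ell where "ell = ln (real N / real k)"
    define P where "P = poisson_vec_pmf (T \<cdot>\<^sub>v (A *\<^sub>v ls))"
    define F where "F l = (l1_norm (ls - l))\<^sup>2 + pen l / T" for l
    have T: "0 < T" using \<tau> n by (simp add: T_def)
    have ell: "1 / 2 \<le> ell" unfolding ell_def using k by (intro half_le_ln) (simp add: field_simps)
    have c0: "0 < c" using \<gamma> k ell by (simp add: c ell_def[symmetric])
    have lsC: "ls \<in> carrier_vec N" "dim_vec ls = N" and LamC: "Lam \<subseteq> carrier_vec N"
      using ls Lam(3) by (auto simp: nonneg_vecs_def)
    have EM: "E \<subseteq> {..<N} \<times> {..<M}" and deg: "\<And>i. i < N \<Longrightarrow> card (E `` {i}) = d"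
      using expand by (auto simp: expander_def)
    have est': "is_pMLE ((1 / real d) \<cdot>\<^sub>m adj_mat N M E) (T * real d)
        ((c * (T * real d * L0)) \<cdot>\<^sub>v indicator_vec N \<Omega>) Lam pen y (lhat y)" if "y \<in> carrier_vec M" for y
      using est that by (simp add: A L T_def)
    have supp: "lhat y \<in> Lam" if "y \<in> set_pmf P" for y
    proof (rule is_pMLE_D(1)[OF est' LamC])
      show "y \<in> carrier_vec M"
        using that set_pmf_poisson_vec[of "T \<cdot>\<^sub>v (A *\<^sub>v ls)"] by (auto simp: P_def A adj_mat_def)
    qed (use T d in \<open>auto simp: indicator_vec_def\<close>)
    note int = integrable_pmf_finite_range[where p = P and h = lhat, OF Lam(1) supp]
    have "k \<le> dim_vec ls" using k lsC by simp
    then obtain S where S: "S \<subseteq> {..<N}" "card S = k" "sigma_k k ls = (\<Sum>i\<in>{..<N} - S. \<bar>ls $ i\<bar>)"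
      unfolding lsC(2)[symmetric] by (rule sigma_k_eq)
    have \<sigma>0: "0 \<le> sigma_k k ls" unfolding S(3) by (simp add: sum_nonneg)
    \<comment> \<open>A minimizer \<open>l\<close> of the oracle expression is the candidate with
      which the estimate is compared.\<close>
    have "Min (F ` Lam) \<in> F ` Lam" using Lam by (intro Min_in) auto
    then obtain l where l: "l \<in> Lam" "Min (F ` Lam) = F l" by auto
    have Fl: "0 \<le> F l" unfolding F_def using pen l T by auto
    define s where "s = sqrt (\<gamma> * real k) * ell"
    define r where "r = ell * sqrt (real k / \<gamma> * F l)"
    have s0: "0 \<le> s" and r0: "0 \<le> r" using ell \<gamma> Fl by (auto simp: s_def r_def)
    have "measure_pmf.expectation P (\<lambda>y. l1_norm (lhat y - ls)) \<le> C * (sigma_k k ls + s) + C * r"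
    proof (cases "\<gamma> < 1")
      case False
      \<comment> \<open>In this case \<open>s\<close> is at least one half, so the trivial error
        bound \<open>2 * L0\<close> is at most \<open>4 * L0 * s\<close>.\<close>
      have "1 \<le> \<gamma> * real k" using False k mult_mono[of 1 \<gamma> 1 "real k"] by simp
      hence "1 \<le> sqrt (\<gamma> * real k)" by simp
      hence "1 * (1 / 2) \<le> s" unfolding s_def using ell by (intro mult_mono) auto
      have "measure_pmf.expectation P (\<lambda>y. l1_norm (lhat y - ls)) \<le> measure_pmf.expectation P (\<lambda>_. 2 * L0)"
      proof (intro integral_mono_AE int[of "\<lambda>l. l1_norm (l - ls)"])
        have "l1_norm (lhat y - ls) \<le> 2 * L0" if "y \<in> set_pmf P" for y
        proof -
          have "lhat y \<in> carrier_vec N" "l1_norm (lhat y) \<le> L0"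
            using supp[OF that] Lam(4) LamC by auto
          thus ?thesis using l1_norm_triangle[of "lhat y" N ls] lsC(1) ls(2) by linarith
        qed
        thus "AE y in measure_pmf P. l1_norm (lhat y - ls) \<le> 2 * L0" by (simp add: AE_measure_pmf_iff)
      qed auto
      also have "\<dots> = 4 * L0 * (1 / 2)" by simp
      also have "\<dots> \<le> C * s" using C \<open>1 * (1 / 2) \<le> s\<close> by (intro mult_mono) auto
      also have "\<dots> \<le> C * (sigma_k k ls + s) + C * r" using C(1) \<sigma>0 r0 by (simp add: distrib_left)
      finally show ?thesis .
    next
      case True
      define R where "R l = (\<Sum>j<M. \<bar>\<Sum>i | i < N \<and> (i, j) \<in> E. l $ i - ls $ i\<bar>)" for l
      have stab: "l1_norm (u - ls) \<le> 7 * sigma_k k ls + 12 * (R u / real d)" if "u \<in> Lam" for u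
      proof -
        have "l1_norm (u - ls) = (\<Sum>i<N. \<bar>u $ i - ls $ i\<bar>)" using lsC by (simp add: l1_norm_def)
        also have "\<dots> \<le> 7 * sigma_k k ls + 12 * (R u / real d)"
          unfolding S(3) R_def using ls(1) that Lam(3)
          by (intro expander_stability[OF expand k(1) d S(1,2)]) (auto simp: nonneg_vecs_def)
        finally show ?thesis .
      qed
      have "measure_pmf.expectation P (\<lambda>y. l1_norm (lhat y - ls))
          \<le> measure_pmf.expectation P (\<lambda>y. 7 * sigma_k k ls + 12 * (R (lhat y) / real d))"
        using stab[OF supp]
        by (intro integral_mono_AE int[of "\<lambda>l. l1_norm (l - ls)"] int[of "\<lambda>l. 7 * sigma_k k ls + 12 * (R l / real d)"])
          (auto simp: AE_measure_pmf_iff)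
      also have "\<dots> = 7 * sigma_k k ls + 12 * (measure_pmf.expectation P (\<lambda>y. R (lhat y)) / real d)"
        using int[of R] by simp
      also have "measure_pmf.expectation P (\<lambda>y. R (lhat y)) / real d
          \<le> c * L0 * real M + sqrt (2 * L0 * (2 + c * real M) *
            (2 * real d * (l1_norm (ls - l))\<^sup>2 / (c * L0) + 2 * c * L0 * real M + 2 * pen l / (T * real d)))"
        unfolding P_def A R_def
        using Lam(4) by (intro pMLE_measurement_error[OF EM deg d cover T c0 assms ls Lam(1,3) _ kraft est' l(1)]) auto
      also have "\<dots> \<le> G1 * s + G2 * r"
        unfolding G1_def G2_def s_def r_def F_def
      proof (rule measurement_error_rate)
        show "real d \<le> \<bar>C1\<bar> * ell"
          using ell by (intro order_trans[OF dC1[folded ell_def] mult_right_mono]) auto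
        have "C2 * (real k * ell) \<le> D * (real k * ell)"
          using ell by (intro mult_right_mono) (auto simp: D_def)
        with MC2 show "real M \<le> D * (real k * ell)" by (simp add: ell_def)
      qed (use k ell \<gamma> True d T pen l assms c in \<open>auto simp: ell_def D_def\<close>)
      finally have "measure_pmf.expectation P (\<lambda>y. l1_norm (lhat y - ls))
          \<le> 7 * sigma_k k ls + 12 * G1 * s + 12 * G2 * r" by simp
      also have "\<dots> \<le> C * sigma_k k ls + C * s + C * r"
        using C \<sigma>0 s0 r0 by (intro add_mono mult_right_mono) auto
      finally show ?thesis by (simp add: distrib_left)
    qed
    thus "measure_pmf.expectation (poisson_vec_pmf ((real n * \<tau>) \<cdot>\<^sub>v (A *\<^sub>v ls)))
        (\<lambda>y. l1_norm (lhat y - ls))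
      \<le> C * (sigma_k k ls + sqrt (\<gamma> * real k) * ln (real N / real k))
        + C * (ln (real N / real k) *
            sqrt (real k / \<gamma> * (MIN l\<in>Lam. (l1_norm (ls - l))\<^sup>2 + pen l / (real n * \<tau>))))"
      unfolding s_def r_def l(2)[symmetric] unfolding P_def ell_def F_def T_def .
  qed
qed

end
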